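(* Let $X$ be a complete $\mathrm{CAT}(1)$ space such that $d(v,v')<\pi/2$ for every $v,v'\in X$. Let $T_1,T_2,\ldots,T_r$ be a finite number of quasinonexpansive and $\Delta$-demiclosed mappings of $X$ into itself such that $F:=\bigcap_{i=1}^rF(T_i)\neq\emptyset$, and let $\alpha_{n,1},\alpha_{n,2},\ldots,\alpha_{n,r}$ be real numbers for $n\in\mathbb{N}$ such that $\alpha_{n,i}\in[a,1-a]$ for every $n\in\mathbb{N}$ and $i=1,2,\ldots,r$, where $0<a<1/2$. For $n\in\mathbb{N}$, let $W_n$ be the $W$-mapping of $X$ into itself generated by $T_1,T_2,\ldots,T_r$ and $\alpha_{n,1},\alpha_{n,2},\ldots,\alpha_{n,r}$. Let $\{\beta_n\}$ be a sequence of real numbers such that $0<\beta_n<1$ for every $n\in\mathbb{N}$, $\lim_{n\to\infty}\beta_n=0$ and $\sum_{n=1}^\infty\beta_n=\infty$. For given points $u,x_1\in X$, let $\{x_n\}$ be the sequence in $X$ generated by \[ x_{n+1}=\beta_nu\oplus(1-\beta_n)W_nx_n \] for $n\in\mathbb{N}$. Suppose that one of the following conditions holds: (a) $\sup_{v,v'\in X}d(v,v')<\pi/2$; (b) $d(u,P_Fu)<\pi/4$ and $d(u,P_Fu)+d(x_1,P_Fu)<\pi/2$; (c) $\sum_{n=1}^\infty\beta_n^2=\infty$. Then $\{x_n\}$ converges (in the metric $d$) to $P_Fu$.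
   Context: Let $(X,d)$ be a metric space. A geodesic of $x,y\in X$ is a mapping $c:[0,l]\to X$ with $c(0)=x$, $c(l)=y$ and $d(c(s),c(t))=|s-t|$ for all $s,t\in[0,l]$. The space $X$ is always assumed to be $\pi$-geodesic (a geodesic of $x,y$ exists whenever $d(x,y)<\pi$) and every geodesic is assumed to be unique; $[x,y]:=c([0,l])$ is the geodesic segment. For $t\in[0,1]$, $tx\oplus(1-t)y:=c((1-t)l)$, where $c$ is the geodesic of $x,y$ and $l=d(x,y)$; i.e. it is the point $z\in[x,y]$ with $d(x,z)=(1-t)d(x,y)$. A subset $C$ is convex if $[x,y]\subset C$ for all $x,y\in C$. $\mathrm{CAT}(1)$ space: Let $\mathbb{S}^2$ be the unit sphere in $\mathbb{R}^3$ with spherical metric $d_{\mathbb{S}^2}$. For $x,y,z\in X$ with $d(x,y)+d(y,z)+d(z,x)<2\pi$ there are $\overline{x},\overline{y},\overline{z}\in\mathbb{S}^2$ with the same pairwise distances. For $p\in[x,y]$, a comparison point is $\overline{p}\in[\overline{x},\overline{y}]$ with $d_{\mathbb{S}^2}(\overline{x},\overline{p})=d(x,p)$ (similarly for the other sides). $X$ is a $\mathrm{CAT}(1)$ space if for every such triangle and all $p,q\in[x,y]\cup[y,z]\cup[z,x]$ with comparison points $\overline{p},\overline{q}$ one has $d(p,q)\le d_{\mathbb{S}^2}(\overline{p},\overline{q})$. Mappings: $F(T):=\{z\mid Tz=z\}$. $T:X\to X$ is quasinonexpansive if $d(Tx,p)\le d(x,p)$ for all $x\in X$ and $p\in F(T)$.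 For a bounded sequence $\{x_n\}$ in $X$, its asymptotic center is $AC(\{x_n\}):=\{z\mid \limsup_{n}d(z,x_n)=\inf_{x\in X}\limsup_{n}d(x,x_n)\}$; $\{x_n\}$ is $\Delta$-convergent to $z$ (its $\Delta$-limit) if $AC(\{x_{n_i}\})=\{z\}$ for every subsequence $\{x_{n_i}\}$. $T$ is $\Delta$-demiclosed if for any $\Delta$-convergent sequence $\{x_n\}$ in $X$ with $\lim_{n}d(Tx_n,x_n)=0$, its $\Delta$-limit belongs to $F(T)$. $W$-mapping: for mappings $T_1,\ldots,T_r:X\to X$ and $\alpha_1,\ldots,\alpha_r\in[0,1]$, put $U_1:=\alpha_1T_1\oplus(1-\alpha_1)I$ and $U_k:=\alpha_kT_kU_{k-1}\oplus(1-\alpha_k)I$ for $k=2,\ldots,r$, where $I$ is the identity and these operations are pointwise (e.g. $U_kx=\alpha_kT_kU_{k-1}x\oplus(1-\alpha_k)x$). The $W$-mapping generated by $T_1,\ldots,T_r$ and $\alpha_1,\ldots,\alpha_r$ is $W:=U_r$. Metric projection: if $X$ is a complete $\mathrm{CAT}(1)$ space with $d(v,v')<\pi/2$ for all $v,v'\in X$ and $C\subset X$ is nonempty, closed and convex, then for each $x\in X$ there is a unique point $P_Cx\in C$ with $d(x,P_Cx)=\inf_{y\in C}d(x,y)$. The fixed point set of a quasinonexpansive mapping on such an $X$ is closed and convex, so $P_F$ is defined. *)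

theory Defs
  imports "HOL-Analysis.Analysis"
begin

text \<open>
  Geodesics, segments and the CAT(1) condition are stated for a carrier \<open>M\<close> with a distance
  \<open>d\<close>, so that they apply both to a type of class \<open>metric_space\<close> (carrier \<open>UNIV\<close>, distance
  \<open>dist\<close>) and to the unit sphere with its spherical (not Euclidean) distance.
\<close>

definition geodesic ::
    "'a set \<Rightarrow> ('a \<Rightarrow> 'a \<Rightarrow> real) \<Rightarrow> real \<Rightarrow> (real \<Rightarrow> 'a) \<Rightarrow> 'a \<Rightarrow> 'a \<Rightarrow> bool" where
  "geodesic M d l c x y \<longleftrightarrow>
     0 \<le> l \<and> c ` {0..l} \<subseteq> M \<and> c 0 = x \<and> c l = y \<and>
     (\<forall>s\<in>{0..l}. \<forall>t\<in>{0..l}. d (c s) (c t) = \<bar>s - t\<bar>)"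

text \<open>A geodesic is a function on \<open>{0..l}\<close>; values of \<open>c\<close> outside are irrelevant, so uniqueness is
  equality on \<open>{0..l}\<close>.  The length is forced to be \<open>l = d x y\<close>.\<close>

definition uniquely_pi_geodesic :: "'a set \<Rightarrow> ('a \<Rightarrow> 'a \<Rightarrow> real) \<Rightarrow> bool" where
  "uniquely_pi_geodesic M d \<longleftrightarrow>
     (\<forall>x\<in>M. \<forall>y\<in>M. d x y < pi \<longrightarrow> (\<exists>l c. geodesic M d l c x y)) \<and>
     (\<forall>x\<in>M. \<forall>y\<in>M. \<forall>l c c'. geodesic M d l c x y \<longrightarrow> geodesic M d l c' x y \<longrightarrow>
        (\<forall>t\<in>{0..l}. c t = c' t))"

text \<open>When the geodesic of \<open>x\<close>, \<open>y\<close> is unique, the union ranges over a single image.\<close>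

definition geodesic_segment ::
    "'a set \<Rightarrow> ('a \<Rightarrow> 'a \<Rightarrow> real) \<Rightarrow> 'a \<Rightarrow> 'a \<Rightarrow> 'a set" where
  "geodesic_segment M d x y = \<Union>{c ` {0..l} | l c. geodesic M d l c x y}"

abbreviation S2 :: "(real ^ 3) set" where
  "S2 \<equiv> sphere 0 1"

definition sph_dist :: "real ^ 3 \<Rightarrow> real ^ 3 \<Rightarrow> real" where
  "sph_dist x y = arccos (x \<bullet> y)"

definition comparison_triangle ::
    "('a \<Rightarrow> 'a \<Rightarrow> real) \<Rightarrow> 'a \<Rightarrow> 'a \<Rightarrow> 'a \<Rightarrow> real ^ 3 \<Rightarrow> real ^ 3 \<Rightarrow> real ^ 3 \<Rightarrow> bool" where
  "comparison_triangle d x y z x' y' z' \<longleftrightarrow>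
     x' \<in> S2 \<and> y' \<in> S2 \<and> z' \<in> S2 \<and>
     sph_dist x' y' = d x y \<and> sph_dist y' z' = d y z \<and> sph_dist z' x' = d z x"

definition side_comparison_point ::
    "'a set \<Rightarrow> ('a \<Rightarrow> 'a \<Rightarrow> real) \<Rightarrow> 'a \<Rightarrow> 'a \<Rightarrow> real ^ 3 \<Rightarrow> real ^ 3 \<Rightarrow> 'a \<Rightarrow> real ^ 3 \<Rightarrow> bool" where
  "side_comparison_point M d x y x' y' p p' \<longleftrightarrow>
     p \<in> geodesic_segment M d x y \<and> p' \<in> geodesic_segment S2 sph_dist x' y' \<and>
     sph_dist x' p' = d x p"

definition comparison_point ::
    "'a set \<Rightarrow> ('a \<Rightarrow> 'a \<Rightarrow> real) \<Rightarrow> 'a \<Rightarrow> 'a \<Rightarrow> 'a \<Rightarrow> real ^ 3 \<Rightarrow> real ^ 3 \<Rightarrow> real ^ 3 \<Rightarrow>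
     'a \<Rightarrow> real ^ 3 \<Rightarrow> bool" where
  "comparison_point M d x y z x' y' z' p p' \<longleftrightarrow>
     side_comparison_point M d x y x' y' p p' \<or>
     side_comparison_point M d y z y' z' p p' \<or>
     side_comparison_point M d z x z' x' p p'"

text \<open>Comparison triangles are unique up to an isometry of the sphere, so quantifying over all of
  them is the same as choosing one.\<close>

definition CAT1 :: "'a set \<Rightarrow> ('a \<Rightarrow> 'a \<Rightarrow> real) \<Rightarrow> bool" where
  "CAT1 M d \<longleftrightarrow>
     uniquely_pi_geodesic M d \<and>
     (\<forall>x\<in>M. \<forall>y\<in>M. \<forall>z\<in>M. \<forall>x' y' z'.
        d x y + d y z + d z x < 2 * pi \<longrightarrow> comparison_triangle d x y z x' y' z' \<longrightarrow>
        (\<forall>p q p' q'. comparison_point M d x y z x' y' z' p p' \<longrightarrow>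
           comparison_point M d x y z x' y' z' q q' \<longrightarrow> d p q \<le> sph_dist p' q'))"

text \<open>\<open>geo_comb t x y\<close> is the point \<open>t x \<oplus> (1 - t) y\<close>.\<close>

definition geo_comb :: "real \<Rightarrow> 'a::metric_space \<Rightarrow> 'a \<Rightarrow> 'a" where
  "geo_comb t x y =
     (THE z. \<exists>c. geodesic UNIV dist (dist x y) c x y \<and> z = c ((1 - t) * dist x y))"

definition Fix :: "('a \<Rightarrow> 'a) \<Rightarrow> 'a set" where
  "Fix T = {z. T z = z}"

definition quasinonexpansive :: "('a::metric_space \<Rightarrow> 'a) \<Rightarrow> bool" where
  "quasinonexpansive T \<longleftrightarrow> (\<forall>x. \<forall>p\<in>Fix T. dist (T x) p \<le> dist x p)"

definition asymptotic_center :: "(nat \<Rightarrow> 'a::metric_space) \<Rightarrow> 'a set" where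
  "asymptotic_center xs =
     {z. limsup (\<lambda>n. ereal (dist z (xs n))) = (INF x. limsup (\<lambda>n. ereal (dist x (xs n))))}"

definition delta_convergent :: "(nat \<Rightarrow> 'a::metric_space) \<Rightarrow> 'a \<Rightarrow> bool" where
  "delta_convergent xs z \<longleftrightarrow>
     bounded (range xs) \<and>
     (\<forall>\<sigma>. strict_mono (\<sigma> :: nat \<Rightarrow> nat) \<longrightarrow> asymptotic_center (xs \<circ> \<sigma>) = {z})"

definition delta_demiclosed :: "('a::metric_space \<Rightarrow> 'a) \<Rightarrow> bool" where
  "delta_demiclosed T \<longleftrightarrow>
     (\<forall>xs z. delta_convergent xs z \<longrightarrow> (\<lambda>n. dist (T (xs n)) (xs n)) \<longlonglongrightarrow> 0 \<longrightarrow> z \<in> Fix T)"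

text \<open>\<open>W_mapping T \<alpha> r\<close> is generated by \<open>T 1, \<dots>, T r\<close> and \<open>\<alpha> 1, \<dots>, \<alpha> r\<close>.  Starting the recursion
  from the identity at index \<open>0\<close> gives \<open>U\<^sub>1 = \<alpha>\<^sub>1 T\<^sub>1 \<oplus> (1 - \<alpha>\<^sub>1) I\<close>.\<close>

primrec W_mapping ::
    "(nat \<Rightarrow> 'a::metric_space \<Rightarrow> 'a) \<Rightarrow> (nat \<Rightarrow> real) \<Rightarrow> nat \<Rightarrow> 'a \<Rightarrow> 'a" where
  "W_mapping T \<alpha> 0 = (\<lambda>x. x)"
| "W_mapping T \<alpha> (Suc k) = (\<lambda>x. geo_comb (\<alpha> (Suc k)) (T (Suc k) (W_mapping T \<alpha> k x)) x)"

definition metric_projection :: "'a::metric_space set \<Rightarrow> 'a \<Rightarrow> 'a" where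
  "metric_projection C x = (THE y. y \<in> C \<and> dist x y = (INF z\<in>C. dist x z))"

end

theory Submission
  imports Defs "HOL-Library.Diagonal_Subsequence"
begin

text \<open>
  All metric information about the space enters through one inequality.  For
  \<open>w = t x \<oplus> (1 - t) y\<close> and \<open>l = d(x, y)\<close>,
    \<open>cos d(x, z) sin (t l) + cos d(y, z) sin ((1 - t) l) \<le> cos d(w, z) sin l\<close>
  (\<open>cos_dist_geo_comb_ge\<close>).  On the sphere this is an equality, because \<open>w\<close> is a linear
  combination of \<open>x\<close> and \<open>y\<close> and the cosine of a distance is an inner product; the CAT(1)
  condition for the vertex \<open>z\<close> and the point \<open>w\<close> of the opposite side turns it into an inequality.

  Write \<open>p = P\<^sub>F u\<close>, \<open>y\<^sub>n = W\<^sub>n x\<^sub>n\<close> and \<open>l\<^sub>n = d(u, y\<^sub>n)\<close>.  No stage of a W-mapping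
  increases the distance to \<open>p\<close>, so \<open>d(y\<^sub>n, p) \<le> d(x\<^sub>n, p)\<close>, and all these distances are at most a fixed
  \<open>M < \<pi>/2\<close>.  Fix \<open>\<epsilon>\<close> and let \<open>e\<^sub>n\<close> be the positive part of \<open>1 - \<epsilon> - cos d(x\<^sub>n, p)\<close>.  The claim is
  that eventually \<open>e\<^sub>n\<^sub>+\<^sub>1 \<le> (1 - g\<^sub>n) e\<^sub>n\<close>, where \<open>g\<^sub>n \<rightarrow> 0\<close> and \<open>\<Sum> g\<^sub>n = \<infinity>\<close>; then \<open>e\<^sub>n \<rightarrow> 0\<close>
  (\<open>tendsto_0_if_contracting\<close>), and \<open>x\<^sub>n \<rightarrow> p\<close> because \<open>\<epsilon>\<close> is arbitrary.  There are two kinds of \<open>n\<close>.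

  \<^item> If \<open>l\<^sub>n > d(u, p) - \<eta>\<close> for a small \<open>\<eta>\<close>, the inequality applied to \<open>x\<^sub>n\<^sub>+\<^sub>1\<close> on the geodesic from \<open>u\<close>
    to \<open>y\<^sub>n\<close> gives the contraction with any \<open>g\<^sub>n \<le> \<beta>\<^sub>n cos ((1 - \<beta>\<^sub>n/2) l\<^sub>n)\<close>
    (\<open>ratio_bound_of_far\<close> and \<open>halpern_step_contraction\<close>).  Under (a) and (b) the \<open>l\<^sub>n\<close> are bounded
    away from \<open>\<pi>/2\<close>, and \<open>g\<^sub>n\<close> can be a constant multiple of \<open>\<beta>\<^sub>n\<close>.  In general the cosine is still
    at least \<open>\<beta>\<^sub>n/2\<close>, and \<open>g\<^sub>n = \<beta>\<^sub>n\<^sup>2/2\<close> serves under (c).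
  \<^item> Otherwise \<open>cos d(x\<^sub>n\<^sub>+\<^sub>1, p) > cos d(x\<^sub>n, p) + \<delta>\<close> for a \<open>\<delta> > 0\<close> that does not depend on \<open>n\<close>.
    This gain decreases \<open>e\<^sub>n \<le> 1\<close> at least by the factor \<open>1 - \<delta>\<close>, and \<open>g\<^sub>n \<le> \<delta>\<close> eventually.

  The dichotomy is where the mappings come in.  If it failed, there would be indices \<open>\<sigma> k \<rightarrow> \<infinity>\<close> with
  \<open>l\<^bsub>\<sigma> k\<^esub> \<le> d(u, p) - \<eta>\<close> along which passing from \<open>x\<close> to \<open>W x\<close> gains nothing in the limit.
  Strict convexity then forces \<open>d(T\<^sub>j U\<^sub>j\<^sub>-\<^sub>1 x, x) \<rightarrow> 0\<close> for every stage, from the last stage down to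
  the first (\<open>W_mapping_stages_asymptotically_fixed\<close>).  A \<open>\<Delta>\<close>-convergent subsequence
  (\<open>delta_convergent_subsequence\<close>) has its limit \<open>z\<close> in \<open>F\<close> by demiclosedness, and
  \<open>d(u, z) \<le> d(u, p) - \<eta>\<close> by weak lower semicontinuity of the distance
  (\<open>dist_asymptotic_center_le\<close>); this contradicts the choice of \<open>p\<close> as the nearest point of \<open>F\<close>.

  Nearest points and asymptotic centers both come from one existence and uniqueness lemma,
  \<open>midpoint_maximizer_unique\<close>, applied to the cosine of the function to be minimized.
\<close>

section \<open>Trigonometric inequalities\<close>

lemma abs_cos_diff_le: "\<bar>cos a - cos b\<bar> \<le> \<bar>a - b\<bar>" for a b :: real
proof -
  have "cos a - cos b = 2 * sin ((a + b) / 2) * sin ((b - a) / 2)"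
    by (rule cos_diff_cos)
  also have "\<bar>\<dots>\<bar> = 2 * \<bar>sin ((a + b) / 2)\<bar> * \<bar>sin ((b - a) / 2)\<bar>"
    by (simp add: abs_mult)
  also have "\<dots> \<le> 2 * 1 * \<bar>(b - a) / 2\<bar>"
    by (intro mult_mono abs_sin_x_le_abs_x) auto
  finally show ?thesis by simp
qed

text \<open>Concavity of the sine on \<open>[0, \<pi>]\<close>, compared with its chord from the origin.\<close>

lemma mult_sin_le_sin_mult:
  fixes b x :: real
  assumes "0 \<le> b" "b \<le> 1" "0 \<le> x" "x \<le> pi"
  shows "b * sin x \<le> sin (b * x)"
proof -
  have "concave_on {0..pi} (sin :: real \<Rightarrow> real)"
    unfolding concave_on_def
  proof (rule f''_ge0_imp_convex)
    show "((\<lambda>x. - sin x) has_real_derivative - cos y) (at y)" for y :: real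
      by (auto intro!: derivative_eq_intros)
    show "((\<lambda>x. - cos x) has_real_derivative sin y) (at y)" for y :: real
      by (auto intro!: derivative_eq_intros)
    show "0 \<le> sin y" if "y \<in> {0..pi}" for y :: real
      using that by (simp add: sin_ge_zero)
  qed auto
  from concave_onD[OF this, of b 0 x] show ?thesis
    using assms by simp
qed

lemma sin_diff_sin_scaled:
  "sin l - sin ((1 - t) * l) = 2 * sin (t * l / 2) * cos ((1 - t / 2) * l)" for t l :: real
proof -
  have eq: "(l - (1 - t) * l) / 2 = t * l / 2" "(l + (1 - t) * l) / 2 = (1 - t / 2) * l"
    by (auto simp: field_simps)
  show ?thesis
    unfolding sin_diff_sin[of l "(1 - t) * l"] eq ..
qed

text \<open>At \<open>b = 0\<close> and \<open>l \<ge> D\<close> the claim is \<open>(1 - \<epsilon>) cos l \<le> cos D\<close>, which holds with the slack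
  \<open>\<epsilon> cos D\<close>.  As the cosine is 1-Lipschitz, moving \<open>l\<close> below \<open>D\<close> by \<open>\<eta>\<close> and \<open>b\<close> up to \<open>\<eta>\<close>
  costs at most \<open>\<eta>\<close> in each of three places, and \<open>\<eta> = \<epsilon> cos D / 4\<close> stays within the slack.\<close>

lemma ratio_bound_of_far:
  fixes D l \<epsilon> b \<eta> :: real
  assumes D: "0 \<le> D" "D < pi / 2" and l: "0 \<le> l" "l < pi / 2" and \<epsilon>: "0 < \<epsilon>" "\<epsilon> < 1"
    and \<eta>: "\<eta> = \<epsilon> * cos D / 4" and b: "0 \<le> b" "b \<le> \<eta>" and far: "D - \<eta> < l"
  shows "(1 - \<epsilon>) * cos ((1 - b / 2) * l) \<le> cos D * cos (b * l / 2)"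
proof -
  have cD: "0 < cos D" using D by (intro cos_gt_zero_pi) auto
  have "0 < \<eta>" unfolding \<eta> using cD \<epsilon> by simp
  have bl: "0 \<le> b * l / 2" "b * l / 2 \<le> b"
  proof -
    show "0 \<le> b * l / 2" using b l by simp
    have "l / 2 \<le> 1" using l pi_less_4 by linarith
    then have "b * (l / 2) \<le> b * 1" using b by (intro mult_left_mono) auto
    then show "b * l / 2 \<le> b" by simp
  qed
  have "cos ((1 - b / 2) * l) \<le> cos l + \<bar>(1 - b / 2) * l - l\<bar>"
    using abs_cos_diff_le[of "(1 - b / 2) * l" l] by linarith
  also have "\<dots> \<le> cos l + b"
    using bl by (simp add: algebra_simps)
  also have "cos l \<le> cos (min l D)"
    using D l by (intro cos_monotone_0_pi_le) auto
  also have "cos (min l D) \<le> cos D + \<eta>"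
    using abs_cos_diff_le[of "min l D" D] far \<open>0 < \<eta>\<close> by linarith
  finally have "cos ((1 - b / 2) * l) \<le> cos D + 2 * \<eta>"
    using b by linarith
  then have "(1 - \<epsilon>) * cos ((1 - b / 2) * l) \<le> (1 - \<epsilon>) * (cos D + 2 * \<eta>)"
    using \<epsilon> by (intro mult_left_mono) auto
  also have "\<dots> \<le> (1 - \<epsilon>) * cos D + 2 * \<eta>"
    using \<epsilon> \<open>0 < \<eta>\<close> by (simp add: algebra_simps)
  also have "\<dots> \<le> cos D - \<eta>"
    using \<eta> \<open>0 < \<eta>\<close> by (simp add: algebra_simps)
  also have "\<dots> \<le> cos D * (1 - b)"
  proof -
    have "cos D * b \<le> 1 * \<eta>"
      using cD b by (intro mult_mono) auto
    then show ?thesis by (simp add: algebra_simps)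
  qed
  also have "\<dots> \<le> cos D * cos (b * l / 2)"
    using abs_cos_diff_le[of 0 "b * l / 2"] bl cD by (intro mult_left_mono) auto
  finally show ?thesis .
qed

section \<open>Comparison triangles on the sphere\<close>

text \<open>The great circle arc \<open>cos s x + sin s e\<close>, where \<open>e\<close> is the unit vector orthogonal to \<open>x\<close> in the
  plane of \<open>x\<close> and \<open>y\<close>.  The second conclusion is the spherical law behind the whole
  development: the arc is linear in its end points, hence so are inner products with a third vector.\<close>

lemma sphere_geodesic:
  assumes x: "x \<in> S2" and y: "y \<in> S2" and l: "l = sph_dist x y" "l < pi"
  obtains c where "geodesic S2 sph_dist l c x y"
    and "\<And>s z. s \<in> {0..l} \<Longrightarrow> sin l * (c s \<bullet> z) = sin (l - s) * (x \<bullet> z) + sin s * (y \<bullet> z)"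
proof -
  have nx: "x \<bullet> x = 1" and ny: "y \<bullet> y = 1"
    using x y by (auto simp: dot_square_norm)
  have xy: "\<bar>x \<bullet> y\<bar> \<le> 1"
    using Cauchy_Schwarz_ineq2[of x y] x y by simp
  then have cl: "x \<bullet> y = cos l" and l0: "0 \<le> l"
    using l by (auto simp: sph_dist_def arccos_lbound abs_le_iff cos_arccos)
  show thesis
  proof (cases "l = 0")
    case True
    then have "(x - y) \<bullet> (x - y) = 0"
      using cl nx ny by (simp add: inner_diff inner_commute)
    then have "x = y" by simp
    then show thesis
      using x nx True by (intro that[of "\<lambda>_. x"]) (auto simp: geodesic_def sph_dist_def)
  next
    case False
    then have sl: "sin l > 0" using l0 l by (simp add: sin_gt_zero)
    define e where "e = (1 / sin l) *\<^sub>R (y - cos l *\<^sub>R x)"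
    have xe: "x \<bullet> e = 0"
      using nx cl by (simp add: e_def inner_diff)
    have "(y - cos l *\<^sub>R x) \<bullet> (y - cos l *\<^sub>R x) = (sin l)\<^sup>2"
      using nx ny cl
      by (simp add: inner_diff inner_commute sin_squared_eq power2_eq_square algebra_simps)
    then have ee: "e \<bullet> e = 1"
      using sl by (simp add: e_def power2_eq_square)
    define c where "c = (\<lambda>s. cos s *\<^sub>R x + sin s *\<^sub>R e)"
    have cc: "c s \<bullet> c t = cos (s - t)" for s t
      using nx xe ee by (simp add: c_def inner_add inner_commute cos_diff)
    have "norm (c s) = 1" for s
      using cc[of s s] by (simp add: norm_eq_sqrt_inner)
    moreover have "c l = y"
      using sl by (simp add: c_def e_def)
    moreover have "arccos (cos (s - t)) = \<bar>s - t\<bar>" if "s \<in> {0..l}" "t \<in> {0..l}" for s t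
    proof -
      have "arccos (cos \<bar>s - t\<bar>) = \<bar>s - t\<bar>"
        using that l by (intro arccos_cos) auto
      then show ?thesis by simp
    qed
    ultimately have "geodesic S2 sph_dist l c x y"
      using l0 by (auto simp: geodesic_def sph_dist_def cc) (simp add: c_def)
    moreover have "sin l * (c s \<bullet> z) = sin (l - s) * (x \<bullet> z) + sin s * (y \<bullet> z)" for s z
      using sl by (simp add: c_def e_def inner_add inner_diff sin_diff field_simps)
    ultimately show thesis by (rule that)
  qed
qed

text \<open>One side is placed on the equator; the third vertex is then determined, up to a reflection, by the
  spherical law of cosines.  Its last coordinate is real because the triangle inequalities say exactly that
  \<open>cos (C + A) \<le> cos B \<le> cos (C - A)\<close>.\<close>

lemma comparison_triangle_exists:
  fixes d :: "'a \<Rightarrow> 'a \<Rightarrow> real"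
  assumes bounds: "0 < d x y" "0 \<le> d y z" "0 \<le> d z x" "d x y < pi / 2" "d y z < pi / 2" "d z x < pi / 2"
    and triangle: "d x y \<le> d y z + d z x" "d y z \<le> d x y + d z x" "d z x \<le> d x y + d y z"
  obtains x' y' z' where "comparison_triangle d x y z x' y' z'"
proof -
  define A B C where ABC: "A = d x y" "B = d y z" "C = d z x"
  note bounds = bounds[folded ABC] and triangle = triangle[folded ABC]
  have sA: "sin A > 0"
    using bounds by (intro sin_gt_zero) auto
  have sC: "sin C \<ge> 0"
    using bounds by (intro sin_ge_zero) auto
  define v where "v = (cos B - cos C * cos A) / sin A"
  have "cos B \<le> cos \<bar>C - A\<bar>"
    using bounds triangle by (intro cos_monotone_0_pi_le) auto
  then have "cos B - cos C * cos A \<le> sin C * sin A"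
    by (simp add: cos_diff)
  moreover have "cos (C + A) \<le> cos B"
    using bounds triangle by (intro cos_monotone_0_pi_le) auto
  then have "- (sin C * sin A) \<le> cos B - cos C * cos A"
    by (simp add: cos_add)
  ultimately have "\<bar>v\<bar> \<le> sin C"
    using sA by (simp add: v_def abs_le_iff field_simps)
  then have v: "v\<^sup>2 \<le> (sin C)\<^sup>2"
    using sC by (simp add: abs_le_square_iff[symmetric])
  have vA: "sin A * v = cos B - cos C * cos A"
    using sA by (simp add: v_def)
  define x' y' z' :: "real^3" where "x' = vector [1, 0, 0]" and "y' = vector [cos A, sin A, 0]"
    and "z' = vector [cos C, v, sqrt ((sin C)\<^sup>2 - v\<^sup>2)]"
  have "x' \<bullet> x' = 1" "y' \<bullet> y' = 1" "z' \<bullet> z' = 1"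
    "x' \<bullet> y' = cos A" "y' \<bullet> z' = cos B" "z' \<bullet> x' = cos C"
    using v vA sin_cos_squared_add2[of A] sin_cos_squared_add2[of C]
    by (simp_all add: x'_def y'_def z'_def inner_vec_def sum_3 power2_eq_square[symmetric] algebra_simps)
  then have "comparison_triangle d x y z x' y' z'"
    using bounds by (simp add: comparison_triangle_def sph_dist_def norm_eq_sqrt_inner ABC[symmetric] arccos_cos)
  then show thesis by (rule that)
qed

lemma geodesic_endpoints:
  assumes "geodesic M d l c x y"
  shows "0 \<le> l" "c 0 = x" "c l = y"
  using assms by (simp_all add: geodesic_def)

lemma geodesic_segment_memI:
  assumes "geodesic M d l c x y" "s \<in> {0..l}"
  shows "c s \<in> geodesic_segment M d x y"
  using assms unfolding geodesic_segment_def by blast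

lemma endpoint_in_geodesic_segment:
  assumes "geodesic M d l c x y"
  shows "y \<in> geodesic_segment M d x y"
  using geodesic_segment_memI[OF assms, of l] geodesic_endpoints[OF assms] by simp

section \<open>The comparison inequality in a small CAT(1) space\<close>

text \<open>The parameter only names the type, so that facts about the whole space can be
  collected in a locale and interpreted at \<open>TYPE('a)\<close>.\<close>

locale small_CAT1 =
  fixes X :: "'a::metric_space itself"
  assumes CAT1: "CAT1 (UNIV :: 'a set) dist"
    and dist_less: "\<And>v v' :: 'a. dist v v' < pi / 2"
begin

lemma dist_less_pi: "dist v v' < pi" for v v' :: 'a
  using dist_less[of v v'] pi_gt_zero by linarith

lemma cos_dist_pos: "0 < cos (dist v v')" for v v' :: 'a
  using dist_less[of v v'] by (intro cos_gt_zero_pi) (auto intro: less_le_trans[OF _ zero_le_dist])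

lemma geo_comb_geodesic:
  fixes x y :: 'a
  obtains c where "geodesic UNIV dist (dist x y) c x y"
    and "\<And>t. t \<in> {0..1} \<Longrightarrow> geo_comb t x y = c ((1 - t) * dist x y)"
proof -
  from CAT1 have unique: "uniquely_pi_geodesic (UNIV :: 'a set) dist"
    by (simp add: CAT1_def)
  then obtain l c where c: "geodesic UNIV dist l c x y"
    using dist_less_pi[of x y] unfolding uniquely_pi_geodesic_def by blast
  then have "dist (c 0) (c l) = \<bar>0 - l\<bar>"
    using geodesic_endpoints[OF c] unfolding geodesic_def by (metis atLeastAtMost_iff order_refl)
  with c have c: "geodesic UNIV dist (dist x y) c x y"
    by (simp add: geodesic_def)
  have "geo_comb t x y = c ((1 - t) * dist x y)" if "t \<in> {0..1}" for t
    unfolding geo_comb_def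
  proof (rule the_equality)
    fix z assume "\<exists>c'. geodesic UNIV dist (dist x y) c' x y \<and> z = c' ((1 - t) * dist x y)"
    then obtain c' where c': "geodesic UNIV dist (dist x y) c' x y" "z = c' ((1 - t) * dist x y)"
      by blast
    have "(1 - t) * dist x y \<in> {0..dist x y}"
      using that by (auto intro: mult_left_le_one_le)
    with c c' unique show "z = c ((1 - t) * dist x y)"
      unfolding uniquely_pi_geodesic_def by blast
  qed (use c in blast)
  with c show thesis by (rule that)
qed

lemma dist_geo_comb:
  fixes x y :: 'a
  assumes "0 \<le> t" "t \<le> 1"
  shows "dist x (geo_comb t x y) = (1 - t) * dist x y" "dist (geo_comb t x y) y = t * dist x y"
proof -
  obtain c where c: "geodesic UNIV dist (dist x y) c x y"
    and t: "geo_comb t x y = c ((1 - t) * dist x y)"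
    using geo_comb_geodesic[of x y] assms by (metis atLeastAtMost_iff)
  have s: "(1 - t) * dist x y \<in> {0..dist x y}"
    using assms by (auto intro: mult_left_le_one_le)
  have "dist (c 0) (c ((1 - t) * dist x y)) = \<bar>0 - (1 - t) * dist x y\<bar>"
    using c s unfolding geodesic_def by (metis atLeastAtMost_iff order_refl)
  then show "dist x (geo_comb t x y) = (1 - t) * dist x y"
    using c s by (simp add: geodesic_def t)
  have "dist (c ((1 - t) * dist x y)) (c (dist x y)) = \<bar>(1 - t) * dist x y - dist x y\<bar>"
    using c s unfolding geodesic_def by (metis atLeastAtMost_iff order_refl zero_le_dist)
  also have "\<dots> = t * dist x y"
    using assms by (simp add: algebra_simps)
  finally show "dist (geo_comb t x y) y = t * dist x y"
    using c by (simp add: geodesic_def t)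
qed

text \<open>Comparison of the vertex \<open>z\<close> with a point of the opposite side.  Here \<open>sin l\<close> is kept as a
  factor instead of being divided out, so that \<open>x = y\<close> needs no separate formulation.\<close>

lemma cos_dist_geo_comb_ge:
  fixes x y z :: 'a
  assumes "0 \<le> t" "t \<le> 1"
  shows "cos (dist x z) * sin (t * dist x y) + cos (dist y z) * sin ((1 - t) * dist x y)
    \<le> cos (dist (geo_comb t x y) z) * sin (dist x y)"
proof (cases "x = y")
  case False
  define l where "l = dist x y"
  define w where "w = geo_comb t x y"
  define s where "s = (1 - t) * l"
  have l: "0 < l" "l < pi"
    using False dist_less_pi by (auto simp: l_def)
  have s: "s \<in> {0..l}"
    using assms l by (auto simp: s_def)
  have "dist x y \<le> dist y z + dist z x" "dist y z \<le> dist x y + dist z x" "dist z x \<le> dist x y + dist y z"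
    by metric+
  then obtain x' y' z' where triangle: "comparison_triangle dist x y z x' y' z'"
    using False dist_less by (elim comparison_triangle_exists[of dist x y z, rotated -1]) auto
  then have S2: "x' \<in> S2" "y' \<in> S2" "z' \<in> S2" and
    d: "sph_dist x' y' = l" "sph_dist y' z' = dist y z" "sph_dist z' x' = dist z x"
    by (auto simp: comparison_triangle_def l_def)
  have inner_eq: "v \<bullet> v' = cos (sph_dist v v')" if "v \<in> S2" "v' \<in> S2" for v v'
    using Cauchy_Schwarz_ineq2[of v v'] that by (auto simp: sph_dist_def abs_le_iff)
  obtain c where c: "geodesic S2 sph_dist l c x' y'"
    and c_inner: "\<And>s v. s \<in> {0..l} \<Longrightarrow> sin l * (c s \<bullet> v) = sin (l - s) * (x' \<bullet> v) + sin s * (y' \<bullet> v)"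
    using sphere_geodesic[OF S2(1,2)] d l by metis
  obtain b where b: "geodesic S2 sph_dist (dist y z) b y' z'"
    using sphere_geodesic[OF S2(2,3)] d dist_less_pi by metis
  obtain cX where cX: "geodesic UNIV dist l cX x y" and w: "w = cX s"
    using geo_comb_geodesic[of x y] assms unfolding l_def s_def w_def by (metis atLeastAtMost_iff)
  obtain bX where bX: "geodesic UNIV dist (dist y z) bX y z"
    using geo_comb_geodesic[of y z] by metis
  have w': "side_comparison_point UNIV dist x y x' y' w (c s)"
    unfolding side_comparison_point_def
  proof (intro conjI)
    show "w \<in> geodesic_segment UNIV dist x y"
      unfolding w by (rule geodesic_segment_memI[OF cX s])
    show "c s \<in> geodesic_segment S2 sph_dist x' y'"
      by (rule geodesic_segment_memI[OF c s])
    have "sph_dist (c 0) (c s) = \<bar>0 - s\<bar>" "dist (cX 0) (cX s) = \<bar>0 - s\<bar>"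
      using c cX s l by (auto simp: geodesic_def)
    then show "sph_dist x' (c s) = dist x w"
      using geodesic_endpoints[OF c] geodesic_endpoints[OF cX] w by simp
  qed
  have z': "side_comparison_point UNIV dist y z y' z' z z'"
    using endpoint_in_geodesic_segment[OF bX] endpoint_in_geodesic_segment[OF b] d(2)
    by (simp add: side_comparison_point_def)
  have cs: "c s \<in> S2"
    using c s unfolding geodesic_def by blast
  have "dist x y + dist y z + dist z x < 2 * pi"
    using dist_less[of x y] dist_less[of y z] dist_less[of z x] pi_gt_zero by linarith
  then have "dist w z \<le> sph_dist (c s) z'"
    using CAT1 triangle w' z' unfolding CAT1_def comparison_point_def by blast
  moreover have "sph_dist (c s) z' \<le> pi"
    using Cauchy_Schwarz_ineq2[of "c s" z'] cs S2 by (auto simp: sph_dist_def abs_le_iff intro: arccos_ubound)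
  ultimately have "cos (sph_dist (c s) z') \<le> cos (dist w z)"
    by (intro cos_monotone_0_pi_le) auto
  then have "c s \<bullet> z' \<le> cos (dist w z)"
    using inner_eq[OF cs S2(3)] by simp
  then have "sin l * (c s \<bullet> z') \<le> sin l * cos (dist w z)"
    using l by (intro mult_left_mono) (auto intro: sin_ge_zero)
  moreover have "x' \<bullet> z' = cos (dist x z)" "y' \<bullet> z' = cos (dist y z)"
    using inner_eq[OF S2(3,1)] inner_eq[OF S2(2,3)] d by (auto simp: inner_commute dist_commute)
  moreover have "l - s = t * l"
    by (simp add: s_def algebra_simps)
  ultimately show ?thesis
    using c_inner[OF s, of z'] by (simp add: w_def l_def s_def mult.commute)
qed simp

lemma cos_dist_midpoint_ge:
  fixes x y z :: 'a
  shows "(cos (dist x z) + cos (dist y z)) / 2 \<le> cos (dist (geo_comb (1 / 2) x y) z) * cos (dist x y / 2)"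
proof (cases "x = y")
  case True
  then have "geo_comb (1 / 2) x y = x"
    using dist_geo_comb[of "1/2" x y] by simp
  with True show ?thesis by simp
next
  case False
  let ?l = "dist x y" and ?w = "geo_comb (1 / 2) x y"
  have "?l / 2 < pi"
    using dist_less[of x y] pi_gt_zero by linarith
  then have "sin (?l / 2) > 0"
    using False by (intro sin_gt_zero) auto
  moreover have "(cos (dist x z) + cos (dist y z)) * sin (?l / 2) \<le> cos (dist ?w z) * sin (2 * (?l / 2))"
    using cos_dist_geo_comb_ge[of "1/2" x z y] by (simp add: algebra_simps)
  moreover have "sin ?l = 2 * sin (?l / 2) * cos (?l / 2)"
    using sin_double[of "?l / 2"] by simp
  ultimately have "(cos (dist x z) + cos (dist y z)) * sin (?l / 2)
      \<le> (2 * (cos (dist ?w z) * cos (?l / 2))) * sin (?l / 2)"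
    by (simp add: mult_ac)
  with \<open>sin (?l / 2) > 0\<close> show ?thesis
    by (simp only: mult_le_cancel_right_pos) simp
qed

text \<open>Balls are convex, stated for cosines: this follows from the comparison inequality because
  \<open>sin l \<le> sin (t l) + sin ((1 - t) l)\<close>.\<close>

lemma cos_dist_geo_comb_min:
  fixes x y z :: 'a
  assumes t: "0 \<le> t" "t \<le> 1"
  shows "min (cos (dist x z)) (cos (dist y z)) \<le> cos (dist (geo_comb t x y) z)"
proof (cases "x = y")
  case True
  then show ?thesis using dist_geo_comb[of t x y] t by simp
next
  case False
  let ?l = "dist x y" and ?w = "geo_comb t x y"
  let ?m = "min (cos (dist x z)) (cos (dist y z))"
  have l: "0 < ?l" "?l < pi" using False dist_less_pi by auto
  have nn: "0 \<le> sin (t * ?l)" "0 \<le> sin ((1 - t) * ?l)"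
    using t l by (auto intro!: sin_ge_zero intro: order_trans[OF mult_left_le_one_le])
  have "sin ?l = sin (t * ?l + (1 - t) * ?l)" by (simp add: algebra_simps)
  also have "\<dots> \<le> sin (t * ?l) + sin ((1 - t) * ?l)"
    unfolding sin_add using nn mult_left_le[of "cos ((1 - t) * ?l)"] mult_left_le[of "cos (t * ?l)"]
    by (intro add_mono) (auto simp: mult.commute[of "cos _"])
  finally have "?m * sin ?l \<le> ?m * sin (t * ?l) + ?m * sin ((1 - t) * ?l)"
    using cos_dist_pos[of x z] cos_dist_pos[of y z]
    by (simp add: distrib_left[symmetric] mult_left_mono)
  also have "\<dots> \<le> cos (dist x z) * sin (t * ?l) + cos (dist y z) * sin ((1 - t) * ?l)"
    using nn by (intro add_mono mult_right_mono) auto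
  also have "\<dots> \<le> cos (dist ?w z) * sin ?l"
    by (rule cos_dist_geo_comb_ge[OF t])
  finally show ?thesis
    using sin_gt_zero[OF l] by simp
qed

end

section \<open>Maximizers of midpoint-concave functions\<close>

locale complete_small_CAT1 = small_CAT1 X for X :: "'a::complete_space itself"
begin

text \<open>The factor \<open>cos (d(x, y) / 2)\<close> makes the midpoint of two almost maximal points exceed the
  supremum unless the points are close to each other; this needs the supremum to be positive.
  Maximizing sequences are therefore Cauchy.\<close>

lemma midpoint_maximizer_unique:
  fixes \<phi> :: "'a \<Rightarrow> real"
  assumes C: "closed C" and cont: "continuous_on C \<phi>" and bdd: "bdd_above (\<phi> ` C)"
    and x0: "x0 \<in> C" "0 < \<phi> x0"
    and mid_in: "\<And>x y. x \<in> C \<Longrightarrow> y \<in> C \<Longrightarrow> geo_comb (1 / 2) x y \<in> C"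
    and mid: "\<And>x y. x \<in> C \<Longrightarrow> y \<in> C \<Longrightarrow>
      min (\<phi> x) (\<phi> y) \<le> \<phi> (geo_comb (1 / 2) x y) * cos (dist x y / 2)"
  shows "\<exists>!z. z \<in> C \<and> (\<forall>y\<in>C. \<phi> y \<le> \<phi> z)"
proof -
  define S where "S = (SUP y\<in>C. \<phi> y)"
  have S_upper: "\<phi> y \<le> S" if "y \<in> C" for y
    unfolding S_def by (rule cSUP_upper[OF that bdd])
  then have S: "0 < S" using x0 by (meson less_le_trans)
  have close: "\<exists>\<delta>>0. \<forall>x\<in>C. \<forall>y\<in>C. S - \<delta> < \<phi> x \<longrightarrow> S - \<delta> < \<phi> y \<longrightarrow> dist x y < e"
    if e: "0 < e" for e
  proof (intro exI conjI ballI impI)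
    define e' where "e' = min e 1"
    have e': "0 < e'" "e' / 2 < pi" "e' \<le> e"
      using e pi_gt3 by (auto simp: e'_def)
    have "cos (e' / 2) < cos 0"
      using e' by (intro cos_monotone_0_pi) auto
    then show "0 < S * (1 - cos (e' / 2))"
      using S by simp
    fix x y assume xy: "x \<in> C" "y \<in> C"
      and large: "S - S * (1 - cos (e' / 2)) < \<phi> x" "S - S * (1 - cos (e' / 2)) < \<phi> y"
    show "dist x y < e"
    proof (rule ccontr)
      assume "\<not> dist x y < e"
      then have le: "e' / 2 \<le> dist x y / 2" "dist x y / 2 < pi / 2"
        using e' dist_less[of x y] pi_gt_zero by linarith+
      have "min (\<phi> x) (\<phi> y) \<le> \<phi> (geo_comb (1 / 2) x y) * cos (dist x y / 2)"
        by (rule mid[OF xy])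
      also have "\<dots> \<le> S * cos (e' / 2)"
        using S e' le by (intro mult_mono S_upper mid_in xy cos_monotone_0_pi_le cos_ge_zero) auto
      finally show False
        using large by (simp add: algebra_simps)
    qed
  qed
  have "\<exists>y. y \<in> C \<and> S - 1 / real (Suc n) < \<phi> y" for n
    using less_cSUP_iff[of C \<phi> "S - 1 / real (Suc n)"] x0 bdd by (auto simp: S_def)
  then obtain ys where ys: "\<And>n. ys n \<in> C" "\<And>n. S - 1 / real (Suc n) < \<phi> (ys n)"
    by metis
  have "Cauchy ys"
  proof (rule metric_CauchyI)
    fix e :: real assume "0 < e"
    from close[OF this] obtain \<delta> where \<delta>: "0 < \<delta>"
      "\<And>x y. x \<in> C \<Longrightarrow> y \<in> C \<Longrightarrow> S - \<delta> < \<phi> x \<Longrightarrow> S - \<delta> < \<phi> y \<Longrightarrow> dist x y < e"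
      by blast
    obtain N where N: "1 / real (Suc N) < \<delta>"
      using nat_approx_posE[OF \<delta>(1)] by blast
    have "S - \<delta> < \<phi> (ys n)" if "n \<ge> N" for n
    proof -
      have "1 / real (Suc n) \<le> 1 / real (Suc N)"
        using that by (intro divide_left_mono) auto
      with N ys(2)[of n] show ?thesis by linarith
    qed
    with \<delta>(2) ys(1) show "\<exists>M. \<forall>m\<ge>M. \<forall>n\<ge>M. dist (ys m) (ys n) < e"
      by blast
  qed
  then obtain z where z: "ys \<longlonglongrightarrow> z"
    using Cauchy_convergent_iff convergent_def by blast
  have zC: "z \<in> C"
    using closed_sequentially[OF C] ys(1) z by blast
  have "(\<lambda>n. \<phi> (ys n)) \<longlonglongrightarrow> \<phi> z"
    using continuous_on_tendsto_compose[OF cont z zC] ys(1) by simp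
  moreover have "(\<lambda>n. S - 1 / real (Suc n)) \<longlonglongrightarrow> S - 0"
    by (intro tendsto_intros LIMSEQ_Suc lim_1_over_n)
  ultimately have Sz: "S \<le> \<phi> z"
    using ys(2) by (intro LIMSEQ_le[of _ S]) (auto intro: less_imp_le)
  show ?thesis
  proof (rule ex1I[of _ z])
    show "z \<in> C \<and> (\<forall>y\<in>C. \<phi> y \<le> \<phi> z)"
      using zC S_upper Sz by force
    fix z' assume z': "z' \<in> C \<and> (\<forall>y\<in>C. \<phi> y \<le> \<phi> z')"
    then have Sz': "S \<le> \<phi> z'"
      using zC Sz by force
    show "z' = z"
    proof (rule ccontr)
      assume "z' \<noteq> z"
      then obtain \<delta> where "0 < \<delta>"
        "\<forall>x\<in>C. \<forall>y\<in>C. S - \<delta> < \<phi> x \<longrightarrow> S - \<delta> < \<phi> y \<longrightarrow> dist x y < dist z' z"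
        using close[of "dist z' z"] by auto
      then have "dist z' z < dist z' z"
        using z' zC Sz Sz' by (smt (verit))
      then show False by simp
    qed
  qed
qed

end

section \<open>Asymptotic centers\<close>

text \<open>Real-valued, because in a space with distances below \<open>\<pi>/2\<close> the upper limit is finite.\<close>

definition limsup_dist :: "(nat \<Rightarrow> 'a::metric_space) \<Rightarrow> 'a \<Rightarrow> real" where
  "limsup_dist xs y = real_of_ereal (limsup (\<lambda>n. ereal (dist y (xs n))))"

context small_CAT1
begin

lemma bounded_range: "bounded (range (xs :: nat \<Rightarrow> 'a))"
  unfolding bounded_def using dist_less by (meson less_imp_le)

lemma ereal_limsup_dist:
  fixes xs :: "nat \<Rightarrow> 'a"
  shows "limsup (\<lambda>n. ereal (dist y (xs n))) = ereal (limsup_dist xs y)"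
proof -
  let ?L = "limsup (\<lambda>n. ereal (dist y (xs n)))"
  have "?L \<le> ereal (pi / 2)"
    using dist_less by (intro Limsup_bounded) (auto intro!: always_eventually less_imp_le)
  moreover have "0 \<le> ?L"
    by (intro le_Limsup) auto
  ultimately show ?thesis
    unfolding limsup_dist_def by (cases ?L) auto
qed

lemma limsup_dist_nonneg: "0 \<le> limsup_dist xs (y :: 'a)"
proof -
  have "0 \<le> limsup (\<lambda>n. ereal (dist y (xs n)))"
    by (intro le_Limsup) auto
  then show ?thesis by (simp add: ereal_limsup_dist)
qed

lemma limsup_dist_leI:
  fixes xs :: "nat \<Rightarrow> 'a"
  assumes "eventually (\<lambda>n. dist y (xs n) \<le> c) sequentially"
  shows "limsup_dist xs y \<le> c"
proof -
  have "limsup (\<lambda>n. ereal (dist y (xs n))) \<le> ereal c"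
    using assms by (intro Limsup_bounded) auto
  then show ?thesis by (simp add: ereal_limsup_dist)
qed

lemma limsup_dist_lessD:
  fixes xs :: "nat \<Rightarrow> 'a"
  assumes "limsup_dist xs y < c"
  shows "eventually (\<lambda>n. dist y (xs n) < c) sequentially"
proof -
  have "limsup (\<lambda>n. ereal (dist y (xs n))) < ereal c"
    using assms by (simp add: ereal_limsup_dist)
  from Limsup_lessD[OF this] show ?thesis by simp
qed

lemma limsup_dist_le_half_pi: "limsup_dist xs (y :: 'a) \<le> pi / 2"
  using dist_less by (intro limsup_dist_leI always_eventually) (auto intro: less_imp_le)

text \<open>The form in which upper limits are compared below: by eventual bounds with an arbitrarily small
  margin.\<close>

lemma limsup_dist_le_limsup_distI:
  fixes xs ys :: "nat \<Rightarrow> 'a"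
  assumes "\<And>e. 0 < e \<Longrightarrow> eventually (\<lambda>n. dist y (xs n) < limsup_dist ys z + e) sequentially"
  shows "limsup_dist xs y \<le> limsup_dist ys z"
proof (rule field_le_epsilon)
  fix e :: real assume "0 < e"
  from assms[OF this] show "limsup_dist xs y \<le> limsup_dist ys z + e"
    by (intro limsup_dist_leI) (auto elim: eventually_mono)
qed

lemma limsup_dist_lipschitz: "\<bar>limsup_dist xs y - limsup_dist xs z\<bar> \<le> dist y (z :: 'a)"
proof -
  have "limsup_dist xs y \<le> limsup_dist xs z + dist y z" for y z :: 'a
  proof (rule field_le_epsilon)
    fix e :: real assume "0 < e"
    then have "eventually (\<lambda>n. dist z (xs n) < limsup_dist xs z + e) sequentially"
      by (intro limsup_dist_lessD) auto
    then have "eventually (\<lambda>n. dist y (xs n) \<le> limsup_dist xs z + dist y z + e) sequentially"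
      by eventually_elim (use dist_triangle[of y _ z] in \<open>smt (verit)\<close>)
    then show "limsup_dist xs y \<le> limsup_dist xs z + dist y z + e"
      by (rule limsup_dist_leI)
  qed
  from this[of y z] this[of z y] show ?thesis
    by (simp add: dist_commute abs_le_iff)
qed

lemma limsup_dist_subseq_le:
  fixes xs :: "nat \<Rightarrow> 'a"
  assumes "strict_mono \<sigma>"
  shows "limsup_dist (xs \<circ> \<sigma>) y \<le> limsup_dist xs y"
proof (rule limsup_dist_le_limsup_distI)
  fix e :: real assume "0 < e"
  then have "eventually (\<lambda>n. dist y (xs n) < limsup_dist xs y + e) sequentially"
    by (intro limsup_dist_lessD) auto
  from eventually_subseq[OF assms this]
  show "eventually (\<lambda>n. dist y ((xs \<circ> \<sigma>) n) < limsup_dist xs y + e) sequentially"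
    by simp
qed

lemma limsup_dist_shift:
  fixes xs :: "nat \<Rightarrow> 'a"
  shows "limsup_dist (xs \<circ> (+) k) y = limsup_dist xs y"
proof (rule antisym)
  show "limsup_dist (xs \<circ> (+) k) y \<le> limsup_dist xs y"
    by (intro limsup_dist_subseq_le) (simp add: strict_mono_def)
  show "limsup_dist xs y \<le> limsup_dist (xs \<circ> (+) k) y"
  proof (rule limsup_dist_le_limsup_distI)
    fix e :: real assume "0 < e"
    then have "eventually (\<lambda>n. dist y ((xs \<circ> (+) k) n) < limsup_dist (xs \<circ> (+) k) y + e) sequentially"
      using limsup_dist_lessD[of "xs \<circ> (+) k" y "limsup_dist (xs \<circ> (+) k) y + e"] by simp
    then have "eventually (\<lambda>n. dist y (xs (n + k)) < limsup_dist (xs \<circ> (+) k) y + e) sequentially"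
      by (simp add: add.commute)
    then show "eventually (\<lambda>n. dist y (xs n) < limsup_dist (xs \<circ> (+) k) y + e) sequentially"
      by (rule eventually_sequentially_seg[THEN iffD1])
  qed
qed

lemma limsup_dist_cong:
  fixes xs ys :: "nat \<Rightarrow> 'a"
  assumes "(\<lambda>n. dist (xs n) (ys n)) \<longlonglongrightarrow> 0"
  shows "limsup_dist xs y = limsup_dist ys y"
proof -
  have "limsup_dist xs y \<le> limsup_dist ys y" if "(\<lambda>n. dist (xs n) (ys n)) \<longlonglongrightarrow> 0" for xs ys :: "nat \<Rightarrow> 'a"
  proof (rule limsup_dist_le_limsup_distI)
    fix e :: real assume e: "0 < e"
    then have "eventually (\<lambda>n. dist y (ys n) < limsup_dist ys y + e / 2) sequentially"
      by (intro limsup_dist_lessD) auto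
    moreover have "eventually (\<lambda>n. dist (xs n) (ys n) < e / 2) sequentially"
      using order_tendstoD(2)[OF that, of "e / 2"] e by simp
    ultimately show "eventually (\<lambda>n. dist y (xs n) < limsup_dist ys y + e) sequentially"
      by eventually_elim metric
  qed
  from this[OF assms] this[of ys xs] assms show ?thesis
    by (simp add: dist_commute)
qed

lemma mem_asymptotic_center_iff:
  fixes xs :: "nat \<Rightarrow> 'a"
  shows "z \<in> asymptotic_center xs \<longleftrightarrow> (\<forall>y. limsup_dist xs z \<le> limsup_dist xs y)"
proof -
  have "z \<in> asymptotic_center xs \<longleftrightarrow> ereal (limsup_dist xs z) \<le> (INF y. ereal (limsup_dist xs y))"
    unfolding asymptotic_center_def ereal_limsup_dist
    by (auto intro: antisym INF_lower)
  then show ?thesis by (simp add: le_INF_iff)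
qed

text \<open>The midpoint inequality passes to the upper limit by evaluating it at an index
  where the distance of the midpoint is almost its upper limit and the two other distances are not much
  larger than theirs.  Such an index exists because the first condition holds
  frequently and the others eventually.\<close>

lemma cos_limsup_dist_midpoint_ge:
  fixes x y :: 'a
  shows "min (cos (limsup_dist xs x)) (cos (limsup_dist xs y))
    \<le> cos (limsup_dist xs (geo_comb (1 / 2) x y)) * cos (dist x y / 2)"
proof -
  let ?R = "limsup_dist xs" and ?m = "geo_comb (1 / 2) x y"
  define M where "M = max (?R x) (?R y)"
  have M: "0 \<le> M" "M \<le> pi / 2"
    using limsup_dist_nonneg[of xs x] limsup_dist_le_half_pi[of xs x] limsup_dist_le_half_pi[of xs y]
    by (auto simp: M_def max_def)
  have "cos M \<le> cos (?R ?m) * cos (dist x y / 2)"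
  proof (rule field_le_epsilon)
    fix e :: real assume "0 < e"
    define d where "d = min (e / 2) 1"
    have d: "0 < d" "2 * d \<le> e" "d \<le> 1"
      using \<open>0 < e\<close> by (auto simp: d_def)
    have "eventually (\<lambda>n. dist x (xs n) < M + d \<and> dist y (xs n) < M + d \<and> dist ?m (xs n) < ?R ?m + d) sequentially"
      using d by (intro eventually_conj limsup_dist_lessD) (auto simp: M_def)
    moreover have "frequently (\<lambda>n. ?R ?m - d < dist ?m (xs n)) sequentially"
      using limsup_dist_leI[of ?m xs "?R ?m - d"] d by (auto simp: frequently_def not_less)
    ultimately obtain n where n: "dist x (xs n) < M + d" "dist y (xs n) < M + d"
      "\<bar>dist ?m (xs n) - ?R ?m\<bar> < d"
      using frequently_ex[OF frequently_eventually_frequently] by (smt (verit))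
    have cosM: "cos M \<le> cos D + d" if "0 \<le> D" "D < M + d" for D
    proof -
      have "cos (M + d) \<le> cos D"
        using that M d pi_gt3 by (intro cos_monotone_0_pi_le) auto
      with abs_cos_diff_le[of "M + d" M] d show ?thesis by simp
    qed
    have "cos M \<le> (cos (dist x (xs n)) + cos (dist y (xs n))) / 2 + d"
      using add_mono[OF cosM[OF zero_le_dist n(1)] cosM[OF zero_le_dist n(2)]] by (simp add: field_simps)
    also have "\<dots> \<le> cos (dist ?m (xs n)) * cos (dist x y / 2) + d"
      using cos_dist_midpoint_ge[of x "xs n" y] by simp
    also have "\<dots> \<le> (cos (?R ?m) + d) * cos (dist x y / 2) + d"
    proof -
      have "0 \<le> cos (dist x y / 2)"
        using dist_less[of x y] zero_le_dist[of x y] pi_gt_zero by (intro cos_ge_zero) linarith+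
      moreover have "cos (dist ?m (xs n)) \<le> cos (?R ?m) + d"
        using n(3) abs_cos_diff_le[of "dist ?m (xs n)" "?R ?m"] by linarith
      ultimately show ?thesis by (simp add: mult_right_mono)
    qed
    also have "\<dots> \<le> cos (?R ?m) * cos (dist x y / 2) + e"
    proof -
      have "d * cos (dist x y / 2) \<le> d * 1"
        using d by (intro mult_left_mono) auto
      then show ?thesis unfolding distrib_right using d by linarith
    qed
    finally show "cos M \<le> cos (?R ?m) * cos (dist x y / 2) + e" .
  qed
  then show ?thesis
    by (auto simp: M_def max_def min_def split: if_splits)
qed

end

section \<open>Compactness and semicontinuity for \<open>\<Delta>\<close>-convergence\<close>

context complete_small_CAT1
begin

text \<open>The hypothesis says that the supremum of the cosine of \<open>limsup_dist xs\<close> is positive, as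
  the existence of a unique maximizer requires.\<close>

lemma asymptotic_center_singleton:
  fixes xs :: "nat \<Rightarrow> 'a"
  assumes p: "limsup_dist xs p < pi / 2"
  shows "\<exists>z. asymptotic_center xs = {z}"
proof -
  let ?\<phi> = "\<lambda>y. cos (limsup_dist xs y)"
  have "\<exists>!z. z \<in> UNIV \<and> (\<forall>y\<in>UNIV. ?\<phi> y \<le> ?\<phi> z)"
  proof (rule midpoint_maximizer_unique)
    have "1-lipschitz_on UNIV (limsup_dist xs)"
      by (rule lipschitz_onI) (auto simp: dist_real_def limsup_dist_lipschitz)
    then show "continuous_on UNIV ?\<phi>"
      by (intro continuous_on_cos lipschitz_on_continuous_on)
    show "bdd_above (range ?\<phi>)"
      by (intro bdd_aboveI[of _ 1]) auto
    show "0 < ?\<phi> p"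
      using p limsup_dist_nonneg[of xs p] by (intro cos_gt_zero_pi) auto
    show "min (?\<phi> x) (?\<phi> y) \<le> ?\<phi> (geo_comb (1 / 2) x y) * cos (dist x y / 2)" for x y
      by (rule cos_limsup_dist_midpoint_ge)
  qed auto
  then obtain z where z: "\<And>y. ?\<phi> y \<le> ?\<phi> z" and uniq: "\<And>z'. (\<And>y. ?\<phi> y \<le> ?\<phi> z') \<Longrightarrow> z' = z"
    by (metis UNIV_I)
  have iff: "?\<phi> y \<le> ?\<phi> z \<longleftrightarrow> limsup_dist xs z \<le> limsup_dist xs y" for y z
  proof -
    have "limsup_dist xs v \<le> pi" for v
      using limsup_dist_le_half_pi[of xs v] pi_gt_zero by linarith
    then show ?thesis
      by (intro cos_mono_le_eq limsup_dist_nonneg)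
  qed
  have "asymptotic_center xs = {z}"
    using z uniq by (auto simp: mem_asymptotic_center_iff iff)
  then show ?thesis ..
qed

definition asymptotic_radius :: "(nat \<Rightarrow> 'a) \<Rightarrow> real" where
  "asymptotic_radius xs = (INF y. limsup_dist xs y)"

lemma asymptotic_radius_nonneg: "0 \<le> asymptotic_radius xs"
  unfolding asymptotic_radius_def by (intro cINF_greatest limsup_dist_nonneg) simp

lemma asymptotic_radius_le: "asymptotic_radius xs \<le> limsup_dist xs y"
  unfolding asymptotic_radius_def
  by (intro cINF_lower bdd_belowI2[of _ 0] limsup_dist_nonneg) simp

lemma asymptotic_radius_subseq_le:
  fixes xs :: "nat \<Rightarrow> 'a"
  assumes "strict_mono \<sigma>"
  shows "asymptotic_radius (xs \<circ> \<sigma>) \<le> asymptotic_radius xs"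
proof -
  have "asymptotic_radius (xs \<circ> \<sigma>) \<le> limsup_dist xs y" for y
    using asymptotic_radius_le limsup_dist_subseq_le[OF assms] by (rule order_trans)
  then show ?thesis
    unfolding asymptotic_radius_def[of xs] by (intro cINF_greatest) auto
qed

text \<open>Passing to a subsequence can only decrease the asymptotic radius.  Choosing successive
  subsequences whose radius is within \<open>1 / (n + 1)\<close> of the infimum over all further subsequences, the
  diagonal sequence has a radius that cannot be decreased at all.\<close>

lemma regular_subsequence:
  fixes xs :: "nat \<Rightarrow> 'a"
  obtains \<rho> where "strict_mono \<rho>"
    and "\<And>\<tau>. strict_mono \<tau> \<Longrightarrow> asymptotic_radius (xs \<circ> \<rho>) \<le> asymptotic_radius (xs \<circ> \<rho> \<circ> \<tau>)"
proof -
  define P where "P = (\<lambda>n (s :: nat \<Rightarrow> nat). \<forall>\<tau>. strict_mono \<tau> \<longrightarrow>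
    asymptotic_radius (xs \<circ> s) \<le> asymptotic_radius (xs \<circ> s \<circ> \<tau>) + 1 / real (Suc n))"
  interpret subseqs P
  proof
    fix n and s :: "nat \<Rightarrow> nat" assume s: "strict_mono s"
    define A where "A = (\<lambda>\<tau>. asymptotic_radius (xs \<circ> s \<circ> \<tau>)) ` Collect strict_mono"
    have bdd: "bdd_below A"
      unfolding A_def by (intro bdd_belowI2[of _ 0] asymptotic_radius_nonneg)
    have "strict_mono (id :: nat \<Rightarrow> nat)" by (simp add: strict_mono_def)
    then have "A \<noteq> {}" unfolding A_def by blast
    then have "\<exists>a\<in>A. a < Inf A + 1 / real (Suc n)"
      using cInf_less_iff[OF _ bdd, of "Inf A + 1 / real (Suc n)"] by simp
    then obtain \<tau> where \<tau>: "strict_mono \<tau>" "asymptotic_radius (xs \<circ> s \<circ> \<tau>) < Inf A + 1 / real (Suc n)"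
      by (auto simp: A_def)
    have "P n (s \<circ> \<tau>)"
      unfolding P_def
    proof (intro allI impI)
      fix \<tau>' :: "nat \<Rightarrow> nat" assume "strict_mono \<tau>'"
      then have "strict_mono (\<tau> \<circ> \<tau>')" using \<tau>(1) by (intro strict_mono_o)
      then have "asymptotic_radius (xs \<circ> s \<circ> (\<tau> \<circ> \<tau>')) \<in> A"
        unfolding A_def by blast
      then have "Inf A \<le> asymptotic_radius (xs \<circ> s \<circ> (\<tau> \<circ> \<tau>'))"
        using bdd by (rule cInf_lower)
      with \<tau>(2) show "asymptotic_radius (xs \<circ> (s \<circ> \<tau>))
          \<le> asymptotic_radius (xs \<circ> (s \<circ> \<tau>) \<circ> \<tau>') + 1 / real (Suc n)"
        by (simp add: o_assoc)
    qed
    with \<tau>(1) show "\<exists>\<tau>. strict_mono \<tau> \<and> P n (s \<circ> \<tau>)" by blast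
  qed
  have stable: "P n (s \<circ> \<tau>)" if \<tau>: "strict_mono \<tau>" and P: "P n s" for \<tau> n s
    unfolding P_def
  proof (intro allI impI)
    fix \<tau>' :: "nat \<Rightarrow> nat" assume "strict_mono \<tau>'"
    then have "strict_mono (\<tau> \<circ> \<tau>')" using \<tau> by (intro strict_mono_o)
    with P have "asymptotic_radius (xs \<circ> s) \<le> asymptotic_radius (xs \<circ> s \<circ> (\<tau> \<circ> \<tau>')) + 1 / real (Suc n)"
      unfolding P_def by blast
    then show "asymptotic_radius (xs \<circ> (s \<circ> \<tau>))
        \<le> asymptotic_radius (xs \<circ> (s \<circ> \<tau>) \<circ> \<tau>') + 1 / real (Suc n)"
      using asymptotic_radius_subseq_le[OF \<tau>, of "xs \<circ> s"] by (simp add: o_assoc)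
  qed
  have "asymptotic_radius (xs \<circ> diagseq) \<le> asymptotic_radius (xs \<circ> diagseq \<circ> \<tau>)"
    if \<tau>: "strict_mono \<tau>" for \<tau>
  proof (rule field_le_epsilon)
    fix e :: real assume "0 < e"
    then obtain k where k: "1 / real (Suc k) < e"
      using nat_approx_posE by blast
    have shift: "asymptotic_radius (zs \<circ> (+) m) = asymptotic_radius zs" for zs m
      by (simp add: asymptotic_radius_def limsup_dist_shift)
    \<comment> \<open>Near-minimality of level \<open>k\<close> is available for the tail of the diagonal from index \<open>k + 1\<close> on, so \<open>\<tau>\<close> is re-indexed to select from that tail.\<close>
    define \<tau>' where "\<tau>' = (\<lambda>n. \<tau> (n + Suc k) - Suc k)"
    have large: "n + Suc k \<le> \<tau> (n + Suc k)" for n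
      using seq_suble[OF \<tau>] by simp
    have "strict_mono \<tau>'"
      unfolding \<tau>'_def
    proof (rule strict_monoI)
      fix m n :: nat assume "m < n"
      then have "\<tau> (m + Suc k) < \<tau> (n + Suc k)"
        using \<tau> by (simp add: strict_mono_def)
      then show "\<tau> (m + Suc k) - Suc k < \<tau> (n + Suc k) - Suc k"
        using large[of m] by linarith
    qed
    with diagseq_holds[of k, OF stable]
    have "asymptotic_radius (xs \<circ> (diagseq \<circ> (+) (Suc k)))
        \<le> asymptotic_radius (xs \<circ> (diagseq \<circ> (+) (Suc k)) \<circ> \<tau>') + 1 / real (Suc k)"
      unfolding P_def by blast
    moreover have "xs \<circ> (diagseq \<circ> (+) (Suc k)) \<circ> \<tau>' = xs \<circ> diagseq \<circ> \<tau> \<circ> (+) (Suc k)"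
    proof
      fix n
      have "Suc k + \<tau>' n = \<tau> (Suc k + n)"
        using large[of n] by (simp add: \<tau>'_def add.commute)
      then show "(xs \<circ> (diagseq \<circ> (+) (Suc k)) \<circ> \<tau>') n = (xs \<circ> diagseq \<circ> \<tau> \<circ> (+) (Suc k)) n"
        by simp
    qed
    ultimately show "asymptotic_radius (xs \<circ> diagseq) \<le> asymptotic_radius (xs \<circ> diagseq \<circ> \<tau>) + e"
      using k shift[of "xs \<circ> diagseq" "Suc k"] shift[of "xs \<circ> diagseq \<circ> \<tau>" "Suc k"]
      by (simp add: o_assoc)
  qed
  with subseq_diagseq show thesis by (rule that)
qed

text \<open>For a regular subsequence the center \<open>z\<close> attains the common asymptotic radius along every further
  subsequence, so it is the center of each of them.\<close>

lemma delta_convergent_subsequence: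
  fixes xs :: "nat \<Rightarrow> 'a"
  assumes p: "limsup_dist xs p < pi / 2"
  obtains \<rho> z where "strict_mono \<rho>" "delta_convergent (xs \<circ> \<rho>) z"
proof -
  obtain \<rho> where \<rho>: "strict_mono \<rho>"
    and regular: "\<And>\<tau>. strict_mono \<tau> \<Longrightarrow> asymptotic_radius (xs \<circ> \<rho>) \<le> asymptotic_radius (xs \<circ> \<rho> \<circ> \<tau>)"
    using regular_subsequence by blast
  have p': "limsup_dist (xs \<circ> \<rho>) p < pi / 2"
    using limsup_dist_subseq_le[OF \<rho>] p by (rule le_less_trans)
  then obtain z where z: "asymptotic_center (xs \<circ> \<rho>) = {z}"
    using asymptotic_center_singleton by blast
  have "asymptotic_center (xs \<circ> \<rho> \<circ> \<tau>) = {z}" if \<tau>: "strict_mono \<tau>" for \<tau>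
  proof -
    have "limsup_dist (xs \<circ> \<rho>) z \<le> asymptotic_radius (xs \<circ> \<rho>)"
      unfolding asymptotic_radius_def using z mem_asymptotic_center_iff[of z "xs \<circ> \<rho>"]
      by (intro cINF_greatest) auto
    then have "limsup_dist (xs \<circ> \<rho> \<circ> \<tau>) z \<le> limsup_dist (xs \<circ> \<rho> \<circ> \<tau>) y" for y
      using limsup_dist_subseq_le[OF \<tau>, of "xs \<circ> \<rho>" z] regular[OF \<tau>]
        asymptotic_radius_le[of "xs \<circ> \<rho> \<circ> \<tau>" y] by linarith
    then have "z \<in> asymptotic_center (xs \<circ> \<rho> \<circ> \<tau>)"
      by (simp add: mem_asymptotic_center_iff)
    moreover have "\<exists>z. asymptotic_center (xs \<circ> \<rho> \<circ> \<tau>) = {z}"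
      using le_less_trans[OF limsup_dist_subseq_le[OF \<tau>] p'] by (rule asymptotic_center_singleton)
    ultimately show ?thesis by auto
  qed
  with \<rho> show thesis
    by (intro that) (auto simp: delta_convergent_def bounded_range)
qed

end

context small_CAT1
begin

lemma delta_convergent_cong:
  fixes xs ys :: "nat \<Rightarrow> 'a"
  assumes lim: "(\<lambda>n. dist (xs n) (ys n)) \<longlonglongrightarrow> 0" and xs: "delta_convergent xs z"
  shows "delta_convergent ys z"
proof -
  have "asymptotic_center (ys \<circ> \<sigma>) = asymptotic_center (xs \<circ> \<sigma>)" if \<sigma>: "strict_mono \<sigma>" for \<sigma>
  proof -
    have "(\<lambda>n. dist ((xs \<circ> \<sigma>) n) ((ys \<circ> \<sigma>) n)) \<longlonglongrightarrow> 0"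
      using LIMSEQ_subseq_LIMSEQ[OF lim \<sigma>] by (simp add: o_def)
    then show ?thesis
      by (auto simp: mem_asymptotic_center_iff limsup_dist_cong[of "xs \<circ> \<sigma>" "ys \<circ> \<sigma>"] simp del: o_apply)
  qed
  with xs show ?thesis
    by (simp add: delta_convergent_def bounded_range)
qed

text \<open>If the center \<open>z\<close> were outside the ball of radius \<open>c\<close> around \<open>u\<close>, moving it slightly towards \<open>u\<close>
  would not increase its distance to any point of the ball: the moved point \<open>q\<close> would be a second
  asymptotic center.\<close>

lemma dist_asymptotic_center_le:
  fixes xs :: "nat \<Rightarrow> 'a"
  assumes z: "asymptotic_center xs = {z}" and le: "eventually (\<lambda>n. dist u (xs n) \<le> c) sequentially"
  shows "dist u z \<le> c"
proof (rule ccontr)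
  define l where "l = dist u z"
  assume "\<not> dist u z \<le> c"
  then have cl: "c < l" by (simp add: l_def)
  obtain n where "dist u (xs n) \<le> c"
    using eventually_happens[OF le] by auto
  then have c0: "0 \<le> c" using zero_le_dist order_trans by blast
  with cl have l: "0 < l" "l < pi / 2" using dist_less by (auto simp: l_def)
  \<comment> \<open>The length \<open>t l\<close> of the move must be so small that this expression stays positive; at \<open>t = 0\<close> it is \<open>cos c - cos l > 0\<close>.\<close>
  have "((\<lambda>t. cos c * cos (t * l / 2) - cos ((1 - t / 2) * l)) \<longlongrightarrow>
      cos c * cos (0 * l / 2) - cos ((1 - 0 / 2) * l)) (at_right 0)"
    by (intro tendsto_intros) simp_all
  moreover have "cos l < cos c"
    using c0 cl l by (intro cos_monotone_0_pi) auto
  ultimately have "eventually (\<lambda>t. 0 < cos c * cos (t * l / 2) - cos ((1 - t / 2) * l)) (at_right 0)"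
    by (intro order_tendstoD(1)) auto
  moreover have "eventually (\<lambda>t::real. t \<in> {0<..<1}) (at_right 0)"
    by (rule eventually_at_right_real) simp
  ultimately obtain t where t: "0 < t" "t < 1" "cos ((1 - t / 2) * l) < cos c * cos (t * l / 2)"
    using eventually_happens[OF eventually_conj] by (smt (verit) greaterThanLessThan_iff trivial_limit_at_right_real)
  define q where "q = geo_comb t u z"
  have "dist q z = t * l"
    using t by (simp add: q_def l_def dist_geo_comb)
  then have "q \<noteq> z" using t l by auto
  have th: "0 < t * l / 2" "t * l / 2 < pi / 2" "0 \<le> (1 - t / 2) * l" "(1 - t / 2) * l \<le> l"
  proof -
    show "0 < t * l / 2" "0 \<le> (1 - t / 2) * l" using t l by auto
    have "t * l \<le> l" "0 \<le> t * l" using t l by (auto intro: mult_left_le_one_le)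
    then show "t * l / 2 < pi / 2"
      using l(2) pi_gt_zero by linarith
    show "(1 - t / 2) * l \<le> l" using \<open>0 \<le> t * l\<close> by (simp add: algebra_simps)
  qed
  have closer: "dist q y \<le> dist z y" if "dist u y \<le> c" for y
  proof -
    let ?w = "cos (dist z y)"
    have "cos c \<le> cos (dist u y)"
      using that cl l by (intro cos_monotone_0_pi_le) auto
    have s: "0 < sin (t * l / 2)" "0 < cos (t * l / 2)"
      using th pi_gt_zero by (auto intro!: sin_gt_zero cos_gt_zero_pi)
    have double: "sin (t * l) = 2 * sin (t * l / 2) * cos (t * l / 2)"
      using sin_double[of "t * l / 2"] by simp
    have "?w * cos ((1 - t / 2) * l) \<le> 1 * cos ((1 - t / 2) * l)"
      using th l pi_gt_zero by (intro mult_right_mono cos_ge_zero cos_le_one) linarith+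
    also have "\<dots> \<le> cos c * cos (t * l / 2)" using t by simp
    also have "\<dots> \<le> cos (dist u y) * cos (t * l / 2)"
      using s \<open>cos c \<le> cos (dist u y)\<close> by simp
    finally have "2 * sin (t * l / 2) * (?w * cos ((1 - t / 2) * l))
        \<le> 2 * sin (t * l / 2) * (cos (dist u y) * cos (t * l / 2))"
      using s by (intro mult_left_mono) auto
    then have "?w * (sin l - sin ((1 - t) * l)) \<le> cos (dist u y) * sin (t * l)"
      unfolding sin_diff_sin_scaled double by (simp add: mult_ac)
    also have "\<dots> + ?w * sin ((1 - t) * l) \<le> cos (dist q y) * sin l"
      using cos_dist_geo_comb_ge[of t u y z] t by (simp add: q_def l_def)
    finally have "?w * sin l \<le> cos (dist q y) * sin l"
      by (simp add: algebra_simps)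
    then have "?w \<le> cos (dist q y)"
      using l by (simp add: sin_gt_zero)
    then show ?thesis
      using dist_less_pi by (subst (asm) cos_mono_le_eq) (auto intro: less_imp_le)
  qed
  have "limsup_dist xs q \<le> limsup_dist xs z"
  proof (rule limsup_dist_le_limsup_distI)
    fix e :: real assume "0 < e"
    then have "eventually (\<lambda>n. dist z (xs n) < limsup_dist xs z + e) sequentially"
      by (intro limsup_dist_lessD) auto
    with le show "eventually (\<lambda>n. dist q (xs n) < limsup_dist xs z + e) sequentially"
      by eventually_elim (use closer in \<open>meson le_less_trans\<close>)
  qed
  moreover have "\<forall>y. limsup_dist xs z \<le> limsup_dist xs y"
    using z mem_asymptotic_center_iff[of z xs] by simp
  ultimately have "q \<in> asymptotic_center xs"
    unfolding mem_asymptotic_center_iff[of q xs] using order_trans by blast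
  with z \<open>q \<noteq> z\<close> show False by simp
qed

end

section \<open>W-mappings\<close>

context small_CAT1
begin

lemma dist_geo_comb_le:
  fixes x y z :: 'a
  assumes t: "0 \<le> t" "t \<le> 1" and c: "dist x z \<le> c" "dist y z \<le> c"
  shows "dist (geo_comb t x y) z \<le> c"
proof -
  have "cos (dist x z) \<le> cos (dist (geo_comb t x y) z) \<or> cos (dist y z) \<le> cos (dist (geo_comb t x y) z)"
    using cos_dist_geo_comb_min[OF t, of x z y] by (auto simp: min_le_iff_disj)
  moreover have "cos (dist v z) \<le> cos (dist w z) \<longleftrightarrow> dist w z \<le> dist v z" for v w :: 'a
    using dist_less_pi by (intro cos_mono_le_eq) (auto intro: less_imp_le)
  ultimately show ?thesis using c by auto
qed

text \<open>Strict convexity, quantified: if \<open>z\<close> is at least as close to \<open>p\<close> as \<open>x\<close>, then a point well inside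
  the segment between them is closer to \<open>p\<close> than \<open>x\<close> by an amount bounded below in terms of the length of the segment.
  The weights in \<open>[a, 1 - a]\<close> keep the point away from the end points.\<close>

lemma cos_dist_gain:
  fixes x z p :: 'a
  assumes a: "0 < a" "a < 1 / 2" and t: "t \<in> {a..1 - a}"
    and zx: "dist z p \<le> dist x p" and M: "dist x p \<le> M" "M < pi / 2"
  shows "2 * cos M * (sin (a * dist z x / 2))\<^sup>2 \<le> cos (dist (geo_comb t z x) p) - cos (dist x p)"
proof (cases "z = x")
  case True
  then have "geo_comb t z x = x"
    using dist_geo_comb[of t z x] t a by simp
  with True show ?thesis by simp
next
  case False
  let ?w = "geo_comb t z x"
  define l where "l = dist z x"
  have l: "0 < l" "l < pi / 2" using False dist_less by (auto simp: l_def)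
  have t01: "0 \<le> t" "t \<le> 1" using t a by auto
  have s: "0 < sin (l / 2)" "0 \<le> cos (l / 2)"
    using l pi_gt_zero by (auto intro!: sin_gt_zero cos_ge_zero)
  have cx: "0 < cos (dist x p)" by (rule cos_dist_pos)
  have cw: "cos (dist x p) \<le> cos (dist ?w p)"
    using dist_geo_comb_le[OF t01 zx order_refl] dist_less_pi[of x p]
    by (intro cos_monotone_0_pi_le) auto
  have cz: "cos (dist x p) \<le> cos (dist z p)"
    using zx dist_less_pi[of x p] by (intro cos_monotone_0_pi_le) auto
  have tl: "0 \<le> t * l" "t * l \<le> pi"
  proof -
    show "0 \<le> t * l" using t01 l by simp
    show "t * l \<le> pi" using t01 l mult_left_le_one_le[of l t] by linarith
  qed
  have eq: "(t * l + (1 - t) * l) / 2 = l / 2" "(t * l - (1 - t) * l) / 2 = (t - 1 / 2) * l"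
    by (auto simp: field_simps)
  have "cos (dist x p) * (2 * sin (l / 2) * cos ((t - 1 / 2) * l))
      = cos (dist x p) * sin (t * l) + cos (dist x p) * sin ((1 - t) * l)"
    unfolding distrib_left[symmetric] sin_plus_sin eq ..
  also have "\<dots> \<le> cos (dist z p) * sin (t * l) + cos (dist x p) * sin ((1 - t) * l)"
    using mult_right_mono[OF cz sin_ge_zero[OF tl]] by simp
  also have "\<dots> \<le> cos (dist ?w p) * sin l"
    unfolding l_def by (rule cos_dist_geo_comb_ge[OF t01])
  also have "\<dots> = cos (dist ?w p) * (2 * sin (l / 2) * cos (l / 2))"
    using sin_double[of "l / 2"] by simp
  finally have "(cos (dist x p) * cos ((t - 1 / 2) * l)) * (2 * sin (l / 2))
      \<le> (cos (dist ?w p) * cos (l / 2)) * (2 * sin (l / 2))"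
    by (simp only: mult_ac)
  then have main: "cos (dist x p) * cos ((t - 1 / 2) * l) \<le> cos (dist ?w p) * cos (l / 2)"
    by (rule mult_right_le_imp_le) (use s(1) in simp)
  have "\<bar>t - 1 / 2\<bar> * l \<le> (1 / 2 - a) * l"
    using t l by (intro mult_right_mono) auto
  moreover have "(1 / 2 - a) * l \<le> pi"
    using a l mult_left_le_one_le[of l "1 / 2 - a"] pi_gt_zero by linarith
  ultimately have "cos ((1 / 2 - a) * l) \<le> cos (\<bar>(t - 1 / 2) * l\<bar>)"
    using l by (intro cos_monotone_0_pi_le) (auto simp: abs_mult)
  then have "cos (dist x p) * cos ((1 / 2 - a) * l) \<le> cos (dist x p) * cos ((t - 1 / 2) * l)"
    using cx by simp
  with main have "cos (dist x p) * cos ((1 / 2 - a) * l) \<le> cos (dist ?w p) * cos (l / 2)"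
    by linarith
  then have "cos (dist x p) * (cos ((1 / 2 - a) * l) - cos (l / 2))
      \<le> (cos (dist ?w p) - cos (dist x p)) * cos (l / 2)"
    by (simp add: algebra_simps)
  also have "\<dots> \<le> cos (dist ?w p) - cos (dist x p)"
    using cw s by (intro mult_right_le_one_le) auto
  finally have upper: "cos (dist x p) * (cos ((1 / 2 - a) * l) - cos (l / 2)) \<le> cos (dist ?w p) - cos (dist x p)" .
  have "a * l \<le> (1 - a) * l" "(1 - a) * l \<le> l" "0 \<le> a * l"
    using a l by (auto intro: mult_right_mono mult_left_le_one_le)
  then have al: "0 \<le> a * l / 2" "a * l / 2 \<le> (1 - a) * l / 2" "(1 - a) * l / 2 \<le> pi / 2"
    using l by linarith+
  have sa: "0 \<le> sin (a * l / 2)" "sin (a * l / 2) \<le> sin ((1 - a) * l / 2)"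
    using al by (auto intro!: sin_ge_zero sin_monotone_2pi_le)
  have eq': "((1 / 2 - a) * l + l / 2) / 2 = (1 - a) * l / 2" "(l / 2 - (1 / 2 - a) * l) / 2 = a * l / 2"
    by (auto simp: field_simps)
  have "2 * cos M * (sin (a * l / 2))\<^sup>2 \<le> 2 * cos (dist x p) * (sin (a * l / 2))\<^sup>2"
    using cos_monotone_0_pi_le[of "dist x p" M] M pi_gt_zero by (intro mult_right_mono) auto
  also have "\<dots> \<le> 2 * cos (dist x p) * (sin ((1 - a) * l / 2) * sin (a * l / 2))"
    using cx sa unfolding power2_eq_square by (intro mult_left_mono mult_right_mono) auto
  also have "\<dots> = cos (dist x p) * (cos ((1 / 2 - a) * l) - cos (l / 2))"
    unfolding cos_diff_cos eq' by (simp only: mult_ac)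
  also note upper
  finally show ?thesis by (simp add: l_def)
qed

lemma dist_tendsto_0_if_no_gain:
  fixes xs zs :: "nat \<Rightarrow> 'a"
  assumes a: "0 < a" "a < 1 / 2" and t: "\<And>n. t n \<in> {a..1 - a}"
    and zx: "\<And>n. dist (zs n) p \<le> dist (xs n) p" and M: "\<And>n. dist (xs n) p \<le> M" "M < pi / 2"
    and lim: "(\<lambda>n. cos (dist (geo_comb (t n) (zs n) (xs n)) p) - cos (dist (xs n) p)) \<longlonglongrightarrow> 0"
  shows "(\<lambda>n. dist (zs n) (xs n)) \<longlonglongrightarrow> 0"
proof -
  let ?s = "\<lambda>n. sin (a * dist (zs n) (xs n) / 2)"
  have "0 \<le> M" using M(1) zero_le_dist order_trans by blast
  then have cM: "0 < cos M" using M(2) by (intro cos_gt_zero_pi) auto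
  have "(\<lambda>n. 2 * cos M * (?s n)\<^sup>2) \<longlonglongrightarrow> 0"
  proof (rule tendsto_sandwich[OF _ _ tendsto_const lim])
    show "eventually (\<lambda>n. 0 \<le> 2 * cos M * (?s n)\<^sup>2) sequentially"
      using cM by simp
    show "eventually (\<lambda>n. 2 * cos M * (?s n)\<^sup>2
        \<le> cos (dist (geo_comb (t n) (zs n) (xs n)) p) - cos (dist (xs n) p)) sequentially"
      by (intro always_eventually allI cos_dist_gain[OF a t zx M])
  qed
  then have "(\<lambda>n. 2 * cos M * (?s n)\<^sup>2 / (2 * cos M)) \<longlonglongrightarrow> 0 / (2 * cos M)"
    using cM by (intro tendsto_divide tendsto_const) auto
  then have "(\<lambda>n. (?s n)\<^sup>2) \<longlonglongrightarrow> 0"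
    using cM by simp
  then have "?s \<longlonglongrightarrow> 0"
    by simp
  then have "(\<lambda>n. arcsin (?s n)) \<longlonglongrightarrow> arcsin 0"
    by (intro continuous_on_tendsto_compose[OF continuous_on_arcsin']) auto
  moreover have "arcsin (?s n) = a * dist (zs n) (xs n) / 2" for n
  proof (rule arcsin_sin)
    have "0 \<le> a * dist (zs n) (xs n)"
      using a by simp
    then show "- (pi / 2) \<le> a * dist (zs n) (xs n) / 2"
      using pi_gt_zero by linarith
    have "a * dist (zs n) (xs n) \<le> dist (zs n) (xs n)"
      using a by (intro mult_left_le_one_le) auto
    then show "a * dist (zs n) (xs n) / 2 \<le> pi / 2"
      using dist_less_pi[of "zs n" "xs n"] by linarith
  qed
  ultimately have "(\<lambda>n. a * dist (zs n) (xs n) / 2) \<longlonglongrightarrow> 0"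
    by simp
  from tendsto_mult_left[OF this, of "2 / a"] show ?thesis
    using a by simp
qed

text \<open>Stage by stage, the new point lies between \<open>x\<close> and a point at least as close to \<open>p\<close> as \<open>x\<close> is.\<close>

lemma dist_W_mapping_le:
  fixes T :: "nat \<Rightarrow> 'a \<Rightarrow> 'a"
  assumes "\<And>i. i \<in> {1..r} \<Longrightarrow> quasinonexpansive (T i)" "\<And>i. i \<in> {1..r} \<Longrightarrow> p \<in> Fix (T i)"
    and "\<And>i. i \<in> {1..r} \<Longrightarrow> \<alpha> i \<in> {0..1}"
  shows "dist (W_mapping T \<alpha> r x) p \<le> dist x p"
  using assms
proof (induction r)
  case (Suc r)
  have "dist (T (Suc r) (W_mapping T \<alpha> r x)) p \<le> dist (W_mapping T \<alpha> r x) p"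
    using Suc.prems(1,2)[of "Suc r"] by (auto simp: quasinonexpansive_def)
  also have "\<dots> \<le> dist x p"
    using Suc by simp
  finally show ?case
    using Suc.prems(3)[of "Suc r"] by (auto intro: dist_geo_comb_le)
qed simp

text \<open>Backwards from the last stage: no gain at \<open>U\<^sub>k x\<close> forces \<open>d(T\<^sub>k U\<^sub>k\<^sub>-\<^sub>1 x, x) \<rightarrow> 0\<close> by strict
  convexity, and since \<open>T\<^sub>k U\<^sub>k\<^sub>-\<^sub>1 x\<close> is at least as close to \<open>p\<close> as \<open>U\<^sub>k\<^sub>-\<^sub>1 x\<close>, there is no gain
  at \<open>U\<^sub>k\<^sub>-\<^sub>1 x\<close> either.\<close>

lemma W_mapping_stages_asymptotically_fixed:
  fixes T :: "nat \<Rightarrow> 'a \<Rightarrow> 'a" and xs :: "nat \<Rightarrow> 'a"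
  assumes a: "0 < a" "a < 1 / 2"
    and "\<And>i. i \<in> {1..r} \<Longrightarrow> quasinonexpansive (T i)" "\<And>i. i \<in> {1..r} \<Longrightarrow> p \<in> Fix (T i)"
    and "\<And>n i. i \<in> {1..r} \<Longrightarrow> \<alpha> n i \<in> {a..1 - a}"
    and M: "\<And>n. dist (xs n) p \<le> M" "M < pi / 2"
    and "(\<lambda>n. cos (dist (W_mapping T (\<alpha> n) r (xs n)) p) - cos (dist (xs n) p)) \<longlonglongrightarrow> 0"
  shows "\<And>j. j \<le> r \<Longrightarrow> (\<lambda>n. dist (W_mapping T (\<alpha> n) j (xs n)) (xs n)) \<longlonglongrightarrow> 0"
    and "\<And>j. j < r \<Longrightarrow> (\<lambda>n. dist (T (Suc j) (W_mapping T (\<alpha> n) j (xs n))) (W_mapping T (\<alpha> n) j (xs n))) \<longlonglongrightarrow> 0"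
proof -
  have "(\<forall>j\<le>r. (\<lambda>n. dist (W_mapping T (\<alpha> n) j (xs n)) (xs n)) \<longlonglongrightarrow> 0) \<and>
    (\<forall>j<r. (\<lambda>n. dist (T (Suc j) (W_mapping T (\<alpha> n) j (xs n))) (W_mapping T (\<alpha> n) j (xs n))) \<longlonglongrightarrow> 0)"
    using assms(3-5,8)
  proof (induction r)
    case (Suc r)
    let ?U = "\<lambda>n. W_mapping T (\<alpha> n) r (xs n)"
    let ?z = "\<lambda>n. T (Suc r) (?U n)"
    have \<alpha>: "\<alpha> n (Suc r) \<in> {a..1 - a}" for n
      using Suc.prems(3) by simp
    have Ux: "dist (?U n) p \<le> dist (xs n) p" for n
    proof (rule dist_W_mapping_le)
      show "\<alpha> n i \<in> {0..1}" if "i \<in> {1..r}" for i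
        using Suc.prems(3)[of i n] that a by auto
    qed (use Suc.prems in auto)
    have zU: "dist (?z n) p \<le> dist (?U n) p" for n
      using Suc.prems(1,2)[of "Suc r"] by (auto simp: quasinonexpansive_def)
    have z_lim: "(\<lambda>n. dist (?z n) (xs n)) \<longlonglongrightarrow> 0"
      using dist_tendsto_0_if_no_gain[OF a \<alpha> _ M, of ?z] Suc.prems(4) order_trans[OF zU Ux] by simp
    have U_lim: "(\<lambda>n. cos (dist (?U n) p) - cos (dist (xs n) p)) \<longlonglongrightarrow> 0"
    proof (rule tendsto_sandwich[OF _ _ tendsto_const z_lim])
      show "eventually (\<lambda>n. 0 \<le> cos (dist (?U n) p) - cos (dist (xs n) p)) sequentially"
      proof (intro always_eventually allI)
        show "0 \<le> cos (dist (?U n) p) - cos (dist (xs n) p)" for n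
          using cos_monotone_0_pi_le[OF zero_le_dist Ux less_imp_le[OF dist_less_pi]] by simp
      qed
      have "cos (dist (?U n) p) - cos (dist (xs n) p) \<le> dist (?z n) (xs n)" for n
      proof -
        have "cos (dist (?U n) p) \<le> cos (dist (?z n) p)"
          using zU dist_less_pi by (intro cos_monotone_0_pi_le) (auto intro: less_imp_le)
        moreover have "\<bar>dist (?z n) p - dist (xs n) p\<bar> \<le> dist (?z n) (xs n)"
          using abs_dist_diff_le[of "?z n" p "xs n"] by (simp add: dist_commute)
        ultimately show ?thesis
          using abs_cos_diff_le[of "dist (?z n) p" "dist (xs n) p"] by linarith
      qed
      then show "eventually (\<lambda>n. cos (dist (?U n) p) - cos (dist (xs n) p) \<le> dist (?z n) (xs n)) sequentially"
        by simp
    qed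
    have IH: "(\<forall>j\<le>r. (\<lambda>n. dist (W_mapping T (\<alpha> n) j (xs n)) (xs n)) \<longlonglongrightarrow> 0) \<and>
      (\<forall>j<r. (\<lambda>n. dist (T (Suc j) (W_mapping T (\<alpha> n) j (xs n))) (W_mapping T (\<alpha> n) j (xs n))) \<longlonglongrightarrow> 0)"
      by (rule Suc.IH[OF Suc.prems(1) Suc.prems(2) Suc.prems(3) U_lim]) simp_all
    have "(\<lambda>n. dist (W_mapping T (\<alpha> n) (Suc r) (xs n)) (xs n)) \<longlonglongrightarrow> 0"
    proof (rule tendsto_sandwich[OF _ _ tendsto_const z_lim])
      have "dist (W_mapping T (\<alpha> n) (Suc r) (xs n)) (xs n) \<le> dist (?z n) (xs n)" for n
      proof -
        have "0 \<le> \<alpha> n (Suc r)" "\<alpha> n (Suc r) \<le> 1" using \<alpha>[of n] a by auto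
        then show ?thesis by (simp add: dist_geo_comb mult_left_le_one_le)
      qed
      then show "eventually (\<lambda>n. dist (W_mapping T (\<alpha> n) (Suc r) (xs n)) (xs n) \<le> dist (?z n) (xs n)) sequentially"
        by (intro always_eventually allI)
    qed simp
    moreover have "(\<lambda>n. dist (?z n) (?U n)) \<longlonglongrightarrow> 0"
    proof (rule tendsto_sandwich[OF _ _ tendsto_const])
      show "(\<lambda>n. dist (?z n) (xs n) + dist (?U n) (xs n)) \<longlonglongrightarrow> 0"
        using tendsto_add[OF z_lim, of "\<lambda>n. dist (?U n) (xs n)" 0] IH by simp
      show "eventually (\<lambda>n. dist (?z n) (?U n) \<le> dist (?z n) (xs n) + dist (?U n) (xs n)) sequentially"
        by (intro always_eventually allI dist_triangle2)
    qed simp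
    ultimately show ?case
      using IH by (auto simp: le_Suc_eq less_Suc_eq simp del: W_mapping.simps(2))
  qed simp
  then show "\<And>j. j \<le> r \<Longrightarrow> (\<lambda>n. dist (W_mapping T (\<alpha> n) j (xs n)) (xs n)) \<longlonglongrightarrow> 0"
    and "\<And>j. j < r \<Longrightarrow> (\<lambda>n. dist (T (Suc j) (W_mapping T (\<alpha> n) j (xs n))) (W_mapping T (\<alpha> n) j (xs n))) \<longlonglongrightarrow> 0"
    by auto
qed

end

section \<open>Fixed point sets and nearest points\<close>

context small_CAT1
begin

text \<open>Fixed points \<open>p\<^sub>n \<rightarrow> x\<close> also converge to \<open>T x\<close>, since \<open>d(T x, p\<^sub>n) \<le> d(x, p\<^sub>n)\<close>.\<close>

lemma closed_Fix:
  fixes T :: "'a \<Rightarrow> 'a"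
  assumes "quasinonexpansive T"
  shows "closed (Fix T)"
proof (subst closed_sequential_limits, intro allI impI, elim conjE)
  fix xs x assume xs: "\<forall>n. xs n \<in> Fix T" "xs \<longlonglongrightarrow> x"
  have "dist (T x) (xs n) \<le> dist (xs n) x" for n
    using assms xs(1) unfolding quasinonexpansive_def by (metis dist_commute)
  then have "xs \<longlonglongrightarrow> T x"
    using xs(2) tendsto_dist_iff[of xs x]
    by (intro metric_tendsto_imp_tendsto[OF xs(2)]) (auto simp: dist_commute)
  with xs(2) show "x \<in> Fix T"
    by (simp add: Fix_def LIMSEQ_unique)
qed

text \<open>The image of the midpoint is within half the distance of both end points, and only the midpoint is.\<close>

lemma midpoint_in_Fix:
  fixes T :: "'a \<Rightarrow> 'a"
  assumes T: "quasinonexpansive T" and pq: "p \<in> Fix T" "q \<in> Fix T"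
  shows "geo_comb (1 / 2) p q \<in> Fix T"
proof (cases "p = q")
  case True
  then have "geo_comb (1 / 2) p q = p"
    using dist_geo_comb[of "1 / 2" p q] by simp
  with pq show ?thesis by simp
next
  case False
  let ?m = "geo_comb (1 / 2) p q" and ?l = "dist p q"
  have l: "0 < ?l" "?l < pi" using False dist_less_pi by auto
  have "dist (T ?m) p \<le> dist ?m p" "dist (T ?m) q \<le> dist ?m q"
    using T pq by (auto simp: quasinonexpansive_def)
  then have "dist p (T ?m) \<le> ?l / 2" "dist q (T ?m) \<le> ?l / 2"
    using dist_geo_comb[of "1 / 2" p q] by (simp_all add: dist_commute)
  then have "cos (?l / 2) \<le> cos (dist p (T ?m))" "cos (?l / 2) \<le> cos (dist q (T ?m))"
    using l by (intro cos_monotone_0_pi_le zero_le_dist; linarith)+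
  with cos_dist_midpoint_ge[of p "T ?m" q]
  have "cos (?l / 2) \<le> cos (dist ?m (T ?m)) * cos (?l / 2)"
    by (simp add: field_simps)
  moreover have "0 < cos (?l / 2)"
    using l by (intro cos_gt_zero_pi) linarith+
  ultimately have "cos 0 \<le> cos (dist ?m (T ?m))"
    by simp
  then have "dist ?m (T ?m) \<le> 0"
    using dist_less_pi[of ?m "T ?m"] by (subst (asm) cos_mono_le_eq) auto
  then show ?thesis by (simp add: Fix_def)
qed

end

context complete_small_CAT1
begin

lemma metric_projection_nearest:
  fixes C :: "'a set"
  assumes C: "closed C" "C \<noteq> {}" and mid: "\<And>x y. x \<in> C \<Longrightarrow> y \<in> C \<Longrightarrow> geo_comb (1 / 2) x y \<in> C"
  shows "metric_projection C u \<in> C" "z \<in> C \<Longrightarrow> dist u (metric_projection C u) \<le> dist u z"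
proof -
  obtain x0 where x0: "x0 \<in> C" using C by blast
  let ?\<phi> = "\<lambda>y. cos (dist u y)"
  have ex1: "\<exists>!z. z \<in> C \<and> (\<forall>y\<in>C. ?\<phi> y \<le> ?\<phi> z)"
  proof (rule midpoint_maximizer_unique[OF C(1) _ _ x0 _ mid])
    show "continuous_on C ?\<phi>" by (intro continuous_intros)
    show "bdd_above (?\<phi> ` C)" by (intro bdd_aboveI[of _ 1]) auto
    show "0 < ?\<phi> x0" by (rule cos_dist_pos)
    show "min (?\<phi> x) (?\<phi> y) \<le> ?\<phi> (geo_comb (1 / 2) x y) * cos (dist x y / 2)" for x y
      using cos_dist_midpoint_ge[of x u y] by (simp add: dist_commute min_def)
  qed
  have nearest: "z \<in> C \<and> dist u z = (INF y\<in>C. dist u y) \<longleftrightarrow> z \<in> C \<and> (\<forall>y\<in>C. ?\<phi> y \<le> ?\<phi> z)" for z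
  proof -
    have "?\<phi> y \<le> ?\<phi> z \<longleftrightarrow> dist u z \<le> dist u y" for y
      using dist_less_pi by (intro cos_mono_le_eq) (auto intro: less_imp_le)
    moreover have "dist u z = (INF y\<in>C. dist u y) \<longleftrightarrow> (\<forall>y\<in>C. dist u z \<le> dist u y)" if "z \<in> C"
    proof
      assume "dist u z = (INF y\<in>C. dist u y)"
      then show "\<forall>y\<in>C. dist u z \<le> dist u y"
        by (auto intro!: cINF_lower bdd_belowI2[of _ 0])
    next
      assume "\<forall>y\<in>C. dist u z \<le> dist u y"
      then show "dist u z = (INF y\<in>C. dist u y)"
        using that by (intro antisym cINF_greatest cINF_lower bdd_belowI2[of _ 0]) auto
    qed
    ultimately show ?thesis by auto
  qed
  have "metric_projection C u = (THE z. z \<in> C \<and> (\<forall>y\<in>C. ?\<phi> y \<le> ?\<phi> z))"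
    unfolding metric_projection_def nearest ..
  with theI'[OF ex1] have P: "metric_projection C u \<in> C \<and> (\<forall>y\<in>C. ?\<phi> y \<le> ?\<phi> (metric_projection C u))"
    by simp
  then show "metric_projection C u \<in> C" by simp
  show "dist u (metric_projection C u) \<le> dist u z" if "z \<in> C"
  proof -
    have "?\<phi> z \<le> ?\<phi> (metric_projection C u)" using P that by blast
    then show ?thesis
      using dist_less_pi by (subst (asm) cos_mono_le_eq) (auto intro: less_imp_le)
  qed
qed

end

section \<open>Common fixed points from iterates without gain\<close>

context complete_small_CAT1
begin

text \<open>The \<open>\<Delta>\<close>-limit of a subsequence is the common fixed point: all stages have the same \<open>\<Delta>\<close>-limit as
  \<open>xs\<close>, so demiclosedness applies to each \<open>T j\<close> at its own stage, while the distance
  bound is inherited from the last stage.\<close>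

lemma exists_common_fixpoint_within:
  fixes T :: "nat \<Rightarrow> 'a \<Rightarrow> 'a" and xs :: "nat \<Rightarrow> 'a"
  assumes a: "0 < a" "a < 1 / 2"
    and T: "\<And>i. i \<in> {1..r} \<Longrightarrow> quasinonexpansive (T i)" "\<And>i. i \<in> {1..r} \<Longrightarrow> p \<in> Fix (T i)"
      "\<And>i. i \<in> {1..r} \<Longrightarrow> delta_demiclosed (T i)"
    and \<alpha>: "\<And>n i. i \<in> {1..r} \<Longrightarrow> \<alpha> n i \<in> {a..1 - a}"
    and M: "\<And>n. dist (xs n) p \<le> M" "M < pi / 2"
    and no_gain: "(\<lambda>n. cos (dist (W_mapping T (\<alpha> n) r (xs n)) p) - cos (dist (xs n) p)) \<longlonglongrightarrow> 0"
    and c: "\<And>n. dist u (W_mapping T (\<alpha> n) r (xs n)) \<le> c"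
  obtains z where "z \<in> (\<Inter>i\<in>{1..r}. Fix (T i))" "dist u z \<le> c"
proof -
  let ?U = "\<lambda>j n. W_mapping T (\<alpha> n) j (xs n)"
  have U_lim: "(\<lambda>n. dist (?U j n) (xs n)) \<longlonglongrightarrow> 0" if "j \<le> r" for j
    by (rule W_mapping_stages_asymptotically_fixed(1)[OF a _ _ _ M no_gain that]) (use T \<alpha> in auto)
  have TU_lim: "(\<lambda>n. dist (T (Suc j) (?U j n)) (?U j n)) \<longlonglongrightarrow> 0" if "j < r" for j
    by (rule W_mapping_stages_asymptotically_fixed(2)[OF a _ _ _ M no_gain that]) (use T \<alpha> in auto)
  have "limsup_dist xs p \<le> M"
    using M(1) by (intro limsup_dist_leI) (simp add: dist_commute)
  with M(2) have "limsup_dist xs p < pi / 2" by linarith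
  then obtain \<rho> z where \<rho>: "strict_mono \<rho>" and z: "delta_convergent (xs \<circ> \<rho>) z"
    using delta_convergent_subsequence by blast
  have U_conv: "delta_convergent (?U j \<circ> \<rho>) z" if "j \<le> r" for j
  proof (rule delta_convergent_cong[OF _ z])
    show "(\<lambda>n. dist ((xs \<circ> \<rho>) n) ((?U j \<circ> \<rho>) n)) \<longlonglongrightarrow> 0"
      using LIMSEQ_subseq_LIMSEQ[OF U_lim[OF that] \<rho>] by (simp add: o_def dist_commute)
  qed
  have "z \<in> Fix (T i)" if i: "i \<in> {1..r}" for i
  proof -
    obtain j where j: "i = Suc j" "j < r" using i by (cases i) auto
    have "(\<lambda>n. dist (T i ((?U j \<circ> \<rho>) n)) ((?U j \<circ> \<rho>) n)) \<longlonglongrightarrow> 0"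
      using LIMSEQ_subseq_LIMSEQ[OF TU_lim[OF j(2)] \<rho>] by (simp add: o_def j)
    then show ?thesis
      using T(3)[OF i] U_conv[of j] j unfolding delta_demiclosed_def by (meson less_imp_le)
  qed
  moreover have "asymptotic_center (?U r \<circ> \<rho> \<circ> id) = {z}"
    using U_conv[of r] unfolding delta_convergent_def by (meson order_refl strict_mono_id)
  then have "dist u z \<le> c"
    using c by (intro dist_asymptotic_center_le[of "?U r \<circ> \<rho>"]) auto
  ultimately show thesis by (intro that) auto
qed

end

section \<open>The Halpern recursion\<close>

text \<open>Since \<open>1 - g \<le> exp (- g)\<close>, the sequence \<open>e\<close> decays like the exponential of minus the partial
  sums of \<open>g\<close>.\<close>

lemma tendsto_0_if_contracting:
  fixes e g :: "nat \<Rightarrow> real"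
  assumes nonneg: "\<And>n. 0 \<le> e n"
    and step: "eventually (\<lambda>n. e (Suc n) \<le> (1 - g n) * e n) sequentially"
    and diverges: "filterlim (\<lambda>N. \<Sum>n=1..N. g n) at_top sequentially"
  shows "e \<longlonglongrightarrow> 0"
proof -
  define S where "S = (\<lambda>N. \<Sum>n=1..N. g n)"
  obtain N where N: "\<And>n. n \<ge> N \<Longrightarrow> e (Suc n) \<le> (1 - g n) * e n"
    using step by (auto simp: eventually_sequentially)
  have decreasing: "e (Suc n) * exp (S n) \<le> e (Suc N) * exp (S N)" if "n \<ge> N" for n
    using that
  proof (induction n rule: dec_induct)
    case (step n)
    have "1 - g (Suc n) \<le> exp (- g (Suc n))"
      using exp_ge_add_one_self[of "- g (Suc n)"] by simp
    then have "e (Suc (Suc n)) \<le> exp (- g (Suc n)) * e (Suc n)"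
      using N[of "Suc n"] step(1) nonneg[of "Suc n"] by (meson le_SucI mult_right_mono order_trans)
    then have "e (Suc (Suc n)) * exp (S (Suc n)) \<le> exp (- g (Suc n)) * e (Suc n) * exp (S (Suc n))"
      by (rule mult_right_mono) simp
    also have "\<dots> = e (Suc n) * exp (S n)"
      by (simp add: S_def exp_add exp_minus)
    finally show ?case using step.IH by simp
  qed simp
  have "e (Suc n) \<le> e (Suc N) * exp (S N) * exp (- S n)" if "n \<ge> N" for n
    using decreasing[OF that] by (simp add: exp_minus field_simps)
  moreover have "(\<lambda>n. e (Suc N) * exp (S N) * exp (- S n)) \<longlonglongrightarrow> e (Suc N) * exp (S N) * 0"
    using diverges unfolding S_def
    by (intro tendsto_mult_left filterlim_compose[OF exp_at_bot]) (simp add: filterlim_uminus_at_bot)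
  ultimately have "(\<lambda>n. e (Suc n)) \<longlonglongrightarrow> 0"
    using nonneg by (intro tendsto_sandwich[of "\<lambda>_. 0" "\<lambda>n. e (Suc n)" _ "\<lambda>n. e (Suc N) * exp (S N) * exp (- S n)"])
      (auto simp: eventually_sequentially)
  then show ?thesis by (rule LIMSEQ_imp_Suc)
qed

context small_CAT1
begin

text \<open>With \<open>\<sigma> = sin ((1 - b) l)\<close>, the comparison inequality exhibits \<open>cos d(w, p) sin l\<close> as
  at least \<open>\<sigma> cos d(y, p)\<close> plus a term in \<open>cos d(u, p)\<close>, and \<open>ratio\<close> says that this term is at least
  \<open>(1 - \<epsilon>) (sin l - \<sigma>)\<close>.  So \<open>cos d(w, p)\<close> dominates an average of \<open>1 - \<epsilon>\<close> and \<open>cos d(y, p)\<close>, in which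
  \<open>1 - \<epsilon>\<close> has the weight \<open>(sin l - \<sigma>) / sin l \<ge> g\<close>.\<close>

lemma halpern_step_contraction:
  fixes u y p :: 'a
  defines "l \<equiv> dist u y"
  assumes b: "0 \<le> b" "b \<le> 1"
    and ratio: "(1 - \<epsilon>) * cos ((1 - b / 2) * l) \<le> cos (dist u p) * cos (b * l / 2)"
    and g: "g \<le> b * cos ((1 - b / 2) * l)"
  shows "max 0 (1 - \<epsilon> - cos (dist (geo_comb b u y) p)) \<le> (1 - g) * max 0 (1 - \<epsilon> - cos (dist y p))"
proof -
  let ?w = "geo_comb b u y" and ?k = "cos ((1 - b / 2) * l)"
  define E where "E = max 0 (1 - \<epsilon> - cos (dist y p))"
  have "b * ?k \<le> b * 1"
    using b by (intro mult_left_mono) auto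
  then have g1: "g \<le> 1" using g b by linarith
  have E: "0 \<le> E" "1 - \<epsilon> - cos (dist y p) \<le> E" by (auto simp: E_def)
  have "1 - \<epsilon> - cos (dist ?w p) \<le> (1 - g) * E"
  proof (cases "u = y")
    case True
    then have "?w = y"
      using dist_geo_comb[OF b, of u y] by simp
    then have "1 - \<epsilon> - cos (dist ?w p) \<le> 0"
      using ratio True by (simp add: l_def)
    also have "\<dots> \<le> (1 - g) * E"
      using g1 E by simp
    finally show ?thesis .
  next
    case False
    then have l: "0 < l" "l < pi / 2" using dist_less by (auto simp: l_def)
    define \<sigma> where "\<sigma> = sin ((1 - b) * l)"
    have half: "0 < sin (l / 2)" "sin l = 2 * sin (l / 2) * cos (l / 2)"
      using l sin_double[of "l / 2"] by (auto intro!: sin_gt_zero)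
    have sl: "0 < sin l" using l by (intro sin_gt_zero) auto
    have bl: "0 \<le> b * l" "b * l \<le> l" using b l by (auto intro: mult_left_le_one_le)
    have "(1 - b / 2) * l \<le> l" "(1 - b) * l \<le> l"
      using b l by (auto intro!: mult_left_le_one_le)
    moreover have "0 \<le> (1 - b / 2) * l" "0 \<le> (1 - b) * l"
      using b l by simp_all
    ultimately have arg: "0 \<le> (1 - b / 2) * l" "(1 - b / 2) * l \<le> pi / 2" "0 \<le> (1 - b) * l" "(1 - b) * l \<le> pi"
      using l by linarith+
    have k: "0 \<le> ?k" using arg by (intro cos_ge_zero) auto
    have sb: "b * sin (l / 2) \<le> sin (b * l / 2)"
      using mult_sin_le_sin_mult[of b "l / 2"] b l by simp
    have \<sigma>: "0 \<le> \<sigma>"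
      unfolding \<sigma>_def using arg by (intro sin_ge_zero) auto
    have diff: "sin l - \<sigma> = 2 * sin (b * l / 2) * ?k"
      unfolding \<sigma>_def by (rule sin_diff_sin_scaled)
    have "g * sin l \<le> b * ?k * sin l"
      using g sl by (intro mult_right_mono) auto
    also have "\<dots> \<le> b * ?k * (2 * sin (l / 2))"
      using b k half by (intro mult_left_mono) (auto intro: mult_right_le_one_le)
    also have "\<dots> = 2 * ?k * (b * sin (l / 2))" by simp
    also have "\<dots> \<le> 2 * ?k * sin (b * l / 2)"
      using sb k by (intro mult_left_mono) auto
    also have "\<dots> = sin l - \<sigma>" by (simp add: diff)
    finally have gs: "\<sigma> \<le> (1 - g) * sin l" by (simp add: algebra_simps)
    have "(1 - \<epsilon>) * (sin l - \<sigma>) = 2 * sin (b * l / 2) * ((1 - \<epsilon>) * ?k)"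
      unfolding diff by simp
    also have "\<dots> \<le> 2 * sin (b * l / 2) * (cos (dist u p) * cos (b * l / 2))"
    proof -
      have "0 \<le> sin (b * l / 2)"
        using bl l by (intro sin_ge_zero) linarith+
      then show ?thesis using ratio by (intro mult_left_mono) auto
    qed
    also have "\<dots> = cos (dist u p) * sin (b * l)"
      using sin_double[of "b * l / 2"] by simp
    finally have "(1 - \<epsilon>) * (sin l - \<sigma>) + cos (dist y p) * \<sigma> \<le> cos (dist ?w p) * sin l"
      using cos_dist_geo_comb_ge[OF b, of u p y] by (simp add: l_def \<sigma>_def)
    then have "(1 - \<epsilon> - cos (dist ?w p)) * sin l \<le> (1 - \<epsilon> - cos (dist y p)) * \<sigma>"
      by (simp add: algebra_simps)
    also have "\<dots> \<le> E * ((1 - g) * sin l)"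
      using E \<sigma> gs by (intro mult_mono) auto
    finally have "(1 - \<epsilon> - cos (dist ?w p)) * sin l \<le> ((1 - g) * E) * sin l"
      by (simp add: mult_ac)
    then show ?thesis using sl by (simp only: mult_le_cancel_right_pos)
  qed
  moreover have "0 \<le> (1 - g) * E" using g1 E by simp
  ultimately show ?thesis by (simp add: E_def)
qed

end

section \<open>Strong convergence\<close>

theorem theorem1p1:
  fixes T :: "nat \<Rightarrow> 'a::complete_space \<Rightarrow> 'a"
    and r :: nat
    and F :: "'a set"
    and a :: real
    and \<alpha> :: "nat \<Rightarrow> nat \<Rightarrow> real"
    and \<beta> :: "nat \<Rightarrow> real"
    and W :: "nat \<Rightarrow> 'a \<Rightarrow> 'a"
    and u :: 'a
    and x :: "nat \<Rightarrow> 'a"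
  assumes "CAT1 (UNIV :: 'a set) dist"
    and "\<forall>v v' :: 'a. dist v v' < pi / 2"
    and "1 \<le> r"
    and "\<forall>i\<in>{1..r}. quasinonexpansive (T i) \<and> delta_demiclosed (T i)"
    and "F = (\<Inter>i\<in>{1..r}. Fix (T i))"
    and "F \<noteq> {}"
    and "0 < a" "a < 1 / 2"
    and "\<forall>n\<ge>1. \<forall>i\<in>{1..r}. \<alpha> n i \<in> {a..1 - a}"
    and "\<forall>n\<ge>1. W n = W_mapping T (\<alpha> n) r"
    and "\<forall>n\<ge>1. 0 < \<beta> n \<and> \<beta> n < 1"
    and "\<beta> \<longlonglongrightarrow> 0"
    and "filterlim (\<lambda>N. \<Sum>n=1..N. \<beta> n) at_top sequentially"
    and "\<forall>n\<ge>1. x (Suc n) = geo_comb (\<beta> n) u (W n (x n))"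
    and "(SUP (v, v') \<in> (UNIV :: 'a set) \<times> (UNIV :: 'a set). dist v v') < pi / 2
       \<or> dist u (metric_projection F u) < pi / 4 \<and>
         dist u (metric_projection F u) + dist (x 1) (metric_projection F u) < pi / 2
       \<or> filterlim (\<lambda>N. \<Sum>n=1..N. (\<beta> n)\<^sup>2) at_top sequentially"
  shows "x \<longlonglongrightarrow> metric_projection F u"
proof -
  interpret complete_small_CAT1 "TYPE('a)"
    using assms(1,2) by unfold_locales auto
  note a = assms(7,8) and \<beta>_lim = assms(12) and \<beta>_sum = assms(13)
  have \<beta>: "0 < \<beta> n" "\<beta> n < 1" if "n \<ge> 1" for n
    using assms(11) that by auto
  have \<alpha>: "\<alpha> n i \<in> {a..1 - a}" if "n \<ge> 1" "i \<in> {1..r}" for n i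
    using assms(9) that by blast
  have quasi: "quasinonexpansive (T i)" and demi: "delta_demiclosed (T i)" if "i \<in> {1..r}" for i
    using assms(4) that by auto
  define p where "p = metric_projection F u"
  have "closed F"
    unfolding assms(5) using quasi by (intro closed_INT ballI closed_Fix) auto
  moreover have "geo_comb (1 / 2) v w \<in> F" if "v \<in> F" "w \<in> F" for v w
    using that midpoint_in_Fix[OF quasi] unfolding assms(5) by blast
  ultimately have pF: "p \<in> F" and p_min: "\<And>z. z \<in> F \<Longrightarrow> dist u p \<le> dist u z"
    unfolding p_def using metric_projection_nearest[OF _ assms(6)] by blast+
  have p_fix: "p \<in> Fix (T i)" if "i \<in> {1..r}" for i
    using pF that by (auto simp: assms(5))
  \<comment> \<open>Everything below concerns indices \<open>n \<ge> 1\<close>; the values at index \<open>0\<close> are arbitrary.\<close>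
  define y where "y = (\<lambda>n. W_mapping T (\<alpha> n) r (x n))"
  define l where "l = (\<lambda>n. dist u (y n))"
  define D where "D = dist u p"
  define M where "M = max D (dist (x 1) p)"
  have D: "0 \<le> D" "D < pi / 2" using dist_less by (auto simp: D_def)
  have M: "0 \<le> M" "M < pi / 2" using dist_less[of "x 1" p] D by (auto simp: M_def max_def)
  have x_Suc: "x (Suc n) = geo_comb (\<beta> n) u (y n)" if "n \<ge> 1" for n
    using assms(10,14) that by (simp add: y_def)
  have yx: "dist (y n) p \<le> dist (x n) p" if "n \<ge> 1" for n
    unfolding y_def
  proof (rule dist_W_mapping_le[OF quasi p_fix])
    show "\<alpha> n i \<in> {0..1}" if "i \<in> {1..r}" for i
      using \<alpha>[OF \<open>n \<ge> 1\<close> that] a by auto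
  qed
  have xM: "dist (x n) p \<le> M" if "n \<ge> 1" for n
    using that
  proof (induction n rule: dec_induct)
    case (step n)
    then have "dist (y n) p \<le> M" using yx[of n] by simp
    then show ?case
      using \<beta>[of n] step(1) x_Suc[of n] by (auto intro!: dist_geo_comb_le simp: M_def D_def)
  qed (simp add: M_def)
  have l: "0 \<le> l n" "l n < pi / 2" for n using dist_less by (auto simp: l_def)
  \<comment> \<open>The contraction rate is the only place where the three alternative conditions differ.\<close>
  obtain g :: "nat \<Rightarrow> real" where g: "\<And>n. n \<ge> 1 \<Longrightarrow> g n \<le> \<beta> n * cos ((1 - \<beta> n / 2) * l n)"
    and g_lim: "g \<longlonglongrightarrow> 0" and g_sum: "filterlim (\<lambda>N. \<Sum>n=1..N. g n) at_top sequentially"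
  proof -
    note witness = that
    have bounded_case: thesis if L: "L < pi / 2" "\<And>n. n \<ge> 1 \<Longrightarrow> l n \<le> L" for L
    proof (rule witness[of "\<lambda>n. \<beta> n * cos L"])
      have "0 \<le> L" using L(2)[of 1] l(1)[of 1] by simp
      then have cL: "0 < cos L" using L(1) by (intro cos_gt_zero_pi) auto
      show "\<beta> n * cos L \<le> \<beta> n * cos ((1 - \<beta> n / 2) * l n)" if "n \<ge> 1" for n
      proof -
        have "(1 - \<beta> n / 2) * l n \<le> l n" "0 \<le> (1 - \<beta> n / 2) * l n"
          using \<beta>[OF that] l(1)[of n] by (auto intro!: mult_left_le_one_le)
        then have "cos L \<le> cos ((1 - \<beta> n / 2) * l n)"
          using L(1) L(2)[OF that] pi_gt_zero by (intro cos_monotone_0_pi_le) linarith+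
        then show ?thesis using \<beta>[OF that] by simp
      qed
      show "(\<lambda>n. \<beta> n * cos L) \<longlonglongrightarrow> 0"
        using tendsto_mult_right[OF \<beta>_lim, of "cos L"] by simp
      show "filterlim (\<lambda>N. \<Sum>n=1..N. \<beta> n * cos L) at_top sequentially"
        using filterlim_at_top_mult_tendsto_pos[OF tendsto_const cL \<beta>_sum]
        by (simp add: sum_distrib_right)
    qed
    consider (a) "(SUP (v, v') \<in> (UNIV :: 'a set) \<times> (UNIV :: 'a set). dist v v') < pi / 2"
      | (b) "D < pi / 4" "D + dist (x 1) p < pi / 2"
      | (c) "filterlim (\<lambda>N. \<Sum>n=1..N. (\<beta> n)\<^sup>2) at_top sequentially"
      using assms(15) unfolding D_def p_def by blast
    then show thesis
    proof cases
      case a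
      have "bdd_above ((\<lambda>(v, v'). dist v v') ` (UNIV \<times> UNIV :: ('a \<times> 'a) set))"
        using dist_less by (intro bdd_aboveI[of _ "pi / 2"]) (auto intro: less_imp_le)
      then have "dist v v' \<le> (SUP (v, v') \<in> (UNIV :: 'a set) \<times> (UNIV :: 'a set). dist v v')" for v v' :: 'a
        using cSUP_upper[of "(v, v')" "UNIV \<times> UNIV" "\<lambda>(v, v'). dist v v'"] by simp
      with a show thesis by (intro bounded_case) (auto simp: l_def)
    next
      case b
      have "l n \<le> D + M" if "n \<ge> 1" for n
        using dist_triangle2[of u "y n" p] yx[OF that] xM[OF that] by (simp add: l_def D_def)
      moreover have "D + M < pi / 2" using b by (auto simp: M_def max_def)
      ultimately show thesis by (intro bounded_case)
    next
      case c
      show thesis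
      proof (rule witness[of "\<lambda>n. (1 / 2) * (\<beta> n)\<^sup>2"])
        show "(1 / 2) * (\<beta> n)\<^sup>2 \<le> \<beta> n * cos ((1 - \<beta> n / 2) * l n)" if "n \<ge> 1" for n
        proof -
          note b = \<beta>[OF that]
          \<comment> \<open>Even for \<open>l n\<close> close to \<open>pi / 2\<close>, the argument of the cosine is at most \<open>pi / 2 - \<beta> n * (pi / 4)\<close>.\<close>
          have "1 / 2 \<le> sin (pi / 4)"
            by (simp add: sin_45)
          then have "\<beta> n * (1 / 2) \<le> \<beta> n * sin (pi / 4)"
            using b by (intro mult_left_mono) auto
          also have "\<dots> \<le> sin (\<beta> n * (pi / 4))"
            using b by (intro mult_sin_le_sin_mult) auto
          also have "\<dots> = cos ((1 - \<beta> n / 2) * (pi / 2))"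
            unfolding sin_cos_eq by (simp add: algebra_simps)
          also have "\<dots> \<le> cos ((1 - \<beta> n / 2) * l n)"
          proof (rule cos_monotone_0_pi_le)
            show "0 \<le> (1 - \<beta> n / 2) * l n" using b l(1) by simp
            show "(1 - \<beta> n / 2) * l n \<le> (1 - \<beta> n / 2) * (pi / 2)"
              using b l(2)[of n] by (intro mult_left_mono) auto
            have "(1 - \<beta> n / 2) * (pi / 2) \<le> pi / 2"
              using b by (intro mult_left_le_one_le) auto
            then show "(1 - \<beta> n / 2) * (pi / 2) \<le> pi"
              using pi_gt_zero by linarith
          qed
          finally have "\<beta> n * (\<beta> n * (1 / 2)) \<le> \<beta> n * cos ((1 - \<beta> n / 2) * l n)"
            using b by (intro mult_left_mono) auto
          then show ?thesis by (simp add: power2_eq_square)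
        qed
        show "(\<lambda>n. (1 / 2) * (\<beta> n)\<^sup>2) \<longlonglongrightarrow> 0"
          using tendsto_mult_left[OF tendsto_power[OF \<beta>_lim, of 2], of "1 / 2"] by simp
        show "filterlim (\<lambda>N. \<Sum>n=1..N. (1 / 2) * (\<beta> n)\<^sup>2) at_top sequentially"
          using filterlim_tendsto_pos_mult_at_top[OF tendsto_const _ c, of "1 / 2"]
          by (simp add: sum_distrib_left)
      qed
    qed
  qed
  have cos_mono: "cos (dist (x n) p) \<le> cos (dist (y n) p)" if "n \<ge> 1" for n
    using yx[OF that] dist_less_pi by (intro cos_monotone_0_pi_le) (auto intro: less_imp_le)
  \<comment> \<open>Eventually, either the step from \<open>x n\<close> to \<open>x (Suc n)\<close> gains a definite amount, or \<open>y n\<close> is at least almost as far from \<open>u\<close> as \<open>p\<close> is.\<close>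
  have far: "\<exists>\<delta>>0. \<exists>N. \<forall>n\<ge>N. cos (dist (x (Suc n)) p) \<le> cos (dist (x n) p) + \<delta> \<longrightarrow> D - \<eta> < l n"
    if "0 < \<eta>" for \<eta>
  proof (rule ccontr)
    assume neg: "\<not> ?thesis"
    have "\<exists>n\<ge>Suc k. cos (dist (x (Suc n)) p) \<le> cos (dist (x n) p) + 1 / real (Suc k) \<and> l n \<le> D - \<eta>" for k
    proof -
      have "0 < 1 / real (Suc k)" by simp
      with neg show ?thesis by (meson not_less)
    qed
    then obtain \<sigma> where \<sigma>: "\<And>k. Suc k \<le> \<sigma> k"
      "\<And>k. cos (dist (x (Suc (\<sigma> k))) p) \<le> cos (dist (x (\<sigma> k)) p) + 1 / real (Suc k)"
      "\<And>k. l (\<sigma> k) \<le> D - \<eta>"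
      by metis
    have \<sigma>1: "1 \<le> \<sigma> k" for k using \<sigma>(1)[of k] by linarith
    have "filterlim \<sigma> at_top sequentially"
      using \<sigma>(1) by (intro filterlim_at_top_mono[OF filterlim_ident]) (auto intro!: always_eventually dest: Suc_leD)
    then have \<beta>\<sigma>: "(\<lambda>k. \<beta> (\<sigma> k)) \<longlonglongrightarrow> 0"
      by (rule filterlim_compose[OF \<beta>_lim])
    \<comment> \<open>\<open>x (Suc n)\<close> is within \<open>\<beta> n * (pi / 2)\<close> of \<open>y n\<close>, so a vanishing gain from \<open>x n\<close> to \<open>x (Suc n)\<close> is a vanishing gain from \<open>x n\<close> to \<open>y n\<close>.\<close>
    have lim: "(\<lambda>k. cos (dist (y (\<sigma> k)) p) - cos (dist (x (\<sigma> k)) p)) \<longlonglongrightarrow> 0"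
    proof (rule tendsto_sandwich[OF _ _ tendsto_const])
      show "eventually (\<lambda>k. 0 \<le> cos (dist (y (\<sigma> k)) p) - cos (dist (x (\<sigma> k)) p)) sequentially"
        using cos_mono[OF \<sigma>1] by simp
      have "cos (dist (y (\<sigma> k)) p) - cos (dist (x (\<sigma> k)) p) \<le> 1 / real (Suc k) + \<beta> (\<sigma> k) * (pi / 2)" for k
      proof -
        let ?n = "\<sigma> k"
        have "dist (x (Suc ?n)) (y ?n) = \<beta> ?n * l ?n"
          using \<beta>[OF \<sigma>1] by (simp add: x_Suc[OF \<sigma>1] dist_geo_comb l_def less_imp_le)
        also have "\<dots> \<le> \<beta> ?n * (pi / 2)"
          using \<beta>[OF \<sigma>1] l(2) by (intro mult_left_mono) (auto intro: less_imp_le)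
        finally have "\<bar>dist (y ?n) p - dist (x (Suc ?n)) p\<bar> \<le> \<beta> ?n * (pi / 2)"
          using abs_dist_diff_le[of "y ?n" p "x (Suc ?n)"] by (simp add: dist_commute)
        then show ?thesis
          using \<sigma>(2)[of k] abs_cos_diff_le[of "dist (y ?n) p" "dist (x (Suc ?n)) p"] by linarith
      qed
      then show "eventually (\<lambda>k. cos (dist (y (\<sigma> k)) p) - cos (dist (x (\<sigma> k)) p)
          \<le> 1 / real (Suc k) + \<beta> (\<sigma> k) * (pi / 2)) sequentially"
        by (intro always_eventually allI)
      have "(\<lambda>k. 1 / real (Suc k) + \<beta> (\<sigma> k) * (pi / 2)) \<longlonglongrightarrow> 0 + 0 * (pi / 2)"
        by (intro tendsto_intros \<beta>\<sigma> LIMSEQ_Suc lim_1_over_n)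
      then show "(\<lambda>k. 1 / real (Suc k) + \<beta> (\<sigma> k) * (pi / 2)) \<longlonglongrightarrow> 0" by simp
    qed
    obtain z where "z \<in> (\<Inter>i\<in>{1..r}. Fix (T i))" "dist u z \<le> D - \<eta>"
    proof (rule exists_common_fixpoint_within[where T = T and r = r and p = p and M = M and u = u
          and xs = "\<lambda>k. x (\<sigma> k)" and \<alpha> = "\<lambda>k. \<alpha> (\<sigma> k)" and c = "D - \<eta>", OF a quasi p_fix demi])
      show "dist u (W_mapping T (\<alpha> (\<sigma> n)) r (x (\<sigma> n))) \<le> D - \<eta>" for n
        using \<sigma>(3) by (simp add: l_def y_def)
    qed (use \<alpha>[OF \<sigma>1] xM[OF \<sigma>1] M lim in \<open>auto simp: y_def\<close>)
    with p_min[of z] that show False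
      by (simp add: assms(5) D_def)
  qed
  have e_lim: "(\<lambda>n. max 0 (1 - \<epsilon> - cos (dist (x n) p))) \<longlonglongrightarrow> 0" if \<epsilon>: "0 < \<epsilon>" "\<epsilon> < 1" for \<epsilon>
  proof (rule tendsto_0_if_contracting[OF _ _ g_sum])
    let ?e = "\<lambda>v. max 0 (1 - \<epsilon> - cos (dist v p))"
    define \<eta> where "\<eta> = \<epsilon> * cos D / 4"
    have "0 < cos D" using D by (intro cos_gt_zero_pi) auto
    then have "0 < \<eta>" using \<epsilon> by (simp add: \<eta>_def)
    from far[OF this] obtain \<delta> N where \<delta>: "0 < \<delta>"
      and N: "\<And>n. n \<ge> N \<Longrightarrow> cos (dist (x (Suc n)) p) \<le> cos (dist (x n) p) + \<delta> \<Longrightarrow> D - \<eta> < l n"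
      by blast
    have "eventually (\<lambda>n. \<beta> n < \<eta>) sequentially"
      using order_tendstoD(2)[OF \<beta>_lim \<open>0 < \<eta>\<close>] .
    moreover have "eventually (\<lambda>n. g n < min \<delta> 1) sequentially"
      using order_tendstoD(2)[OF g_lim, of "min \<delta> 1"] \<delta> by simp
    moreover have "eventually (\<lambda>n. n \<ge> max N 1) sequentially"
      by (rule eventually_ge_at_top)
    ultimately show "eventually (\<lambda>n. ?e (x (Suc n)) \<le> (1 - g n) * ?e (x n)) sequentially"
    proof eventually_elim
      case (elim n)
      then have n: "n \<ge> 1" "n \<ge> N" and gn: "g n \<le> 1" "g n \<le> \<delta>" by auto
      show ?case
      proof (cases "cos (dist (x (Suc n)) p) \<le> cos (dist (x n) p) + \<delta>")
        case True
        have "(1 - \<epsilon>) * cos ((1 - \<beta> n / 2) * l n) \<le> cos D * cos (\<beta> n * l n / 2)"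
          using N[OF n(2) True] \<beta>[OF n(1)] elim(1)
          by (intro ratio_bound_of_far[OF D l \<epsilon> \<eta>_def]) auto
        then have "?e (x (Suc n)) \<le> (1 - g n) * ?e (y n)"
          unfolding x_Suc[OF n(1)] using \<beta>[OF n(1)] g[OF n(1)]
          by (intro halpern_step_contraction) (auto simp: l_def D_def)
        also have "\<dots> \<le> (1 - g n) * ?e (x n)"
          using gn cos_mono[OF n(1)] by (intro mult_left_mono) auto
        finally show ?thesis .
      next
        case False
        define E where "E = ?e (x n)"
        have E: "0 \<le> E" "E \<le> 1" "1 - \<epsilon> - cos (dist (x n) p) \<le> E"
          using cos_dist_pos[of "x n" p] \<epsilon> by (auto simp: E_def max_def)
        have "g n * E \<le> \<delta> * 1"
          using gn \<delta> E by (intro mult_mono) auto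
        then have "1 - \<epsilon> - cos (dist (x (Suc n)) p) \<le> (1 - g n) * E"
          using False E unfolding left_diff_distrib by linarith
        moreover have "0 \<le> (1 - g n) * E" using gn E by simp
        ultimately show ?thesis by (simp add: E_def)
      qed
    qed
  qed simp
  have "(\<lambda>n. cos (dist (x n) p)) \<longlonglongrightarrow> 1"
  proof (rule order_tendstoI)
    fix c :: real assume "c < 1"
    define \<epsilon> where "\<epsilon> = min (1 / 2) ((1 - c) / 2)"
    have \<epsilon>: "0 < \<epsilon>" "\<epsilon> < 1" "c \<le> 1 - 2 * \<epsilon>" using \<open>c < 1\<close> by (auto simp: \<epsilon>_def min_def field_simps)
    have "eventually (\<lambda>n. max 0 (1 - \<epsilon> - cos (dist (x n) p)) < \<epsilon>) sequentially"
      using order_tendstoD(2)[OF e_lim[OF \<epsilon>(1,2)] \<epsilon>(1)] .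
    then show "eventually (\<lambda>n. c < cos (dist (x n) p)) sequentially"
      by eventually_elim (use \<epsilon>(3) in auto)
  next
    fix c :: real assume "1 < c"
    then show "eventually (\<lambda>n. cos (dist (x n) p) < c) sequentially"
      by (intro always_eventually allI) (rule le_less_trans[OF cos_le_one])
  qed
  then have "(\<lambda>n. arccos (cos (dist (x n) p))) \<longlonglongrightarrow> arccos 1"
    by (intro continuous_on_tendsto_compose[OF continuous_on_arccos']) auto
  then have "(\<lambda>n. dist (x n) p) \<longlonglongrightarrow> 0"
    using dist_less_pi by (simp add: arccos_cos less_imp_le)
  then show ?thesis
    unfolding p_def[symmetric] by (rule tendsto_dist_iff[THEN iffD2])
qed

end
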